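(* Let $p$ be a prime, let $\Bbbk$ be a commutative domain of characteristic $p$, and let $X=\Bbbk[x]/(x^p)$. If $\mathscr L$ is a (restricted) Lie subalgebra of $\mathscr W(X)$ that is generated by elements that are bounded and $\ell$-evanescent, for some $\ell\in\mathbb N$ (common to all the generators), then $\mathscr L$ is nil.
   Context: Tensor products are over $\Bbbk$. $\mathrm{Der}\,X$ is the Lie algebra of $\Bbbk$-linear derivations of $X$; $\partial_x=d/dx$. Algebras are restricted: subalgebras are closed under the bracket and the $p$-mapping, and "generated" is meant as restricted Lie algebra. **The algebra $\mathscr W(X)$.** As a module, $\mathscr W(X)=\prod_{n\ge0}X^{\otimes n}\otimes \mathrm{Der}\,X$; its elements are written $a=(a_0,a_1,\dots)$ with $a_n\in X^{\otimes n}\otimes\mathrm{Der}\,X$. It acts by $\Bbbk$-linear endomorphisms on $T(X)=\bigoplus_{n\ge0}X^{\otimes n}$: the element $x_1\otimes\cdots\otimes x_n\otimes\delta$ sends $v_1\otimes\cdots\otimes v_k$ to $x_1v_1\otimes\cdots\otimes x_nv_n\otimes\delta(v_{n+1})\otimes v_{n+2}\otimes\cdots\otimes v_k$ if $k>n$, and to $0$ if $k\le n$. The bracket on $\mathscr W(X)$ is the commutator and the $p$-mapping $a\mapsto a^p$ is the $p$-th power of these endomorphisms. **Bounded elements.** Let $\varepsilon:X\to\Bbbk$ be the augmentation with kernel $xX$. Let $R(X)=\bigcup_{n\ge0}X^{\otimes n}$, a commutative algebra, where $X^{\otimes n}$ is embedded in $X^{\otimes n+1}$ by $v\mapsto v\otimes1$.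 Let $\varpi\subset R(X)$ be its augmentation ideal, the union of the kernels of $\varepsilon\otimes\cdots\otimes\varepsilon:X^{\otimes n}\to\Bbbk$. The algebra $R(X)$ acts on $\mathscr W(X)$ as follows: for $f=x_1\otimes\cdots\otimes x_m\in R(X)$ and $b=y_1\otimes\cdots\otimes y_n\otimes\delta$, after appending factors $1$ to $f$ so that $m\ge n$, put $f\cdot b=\varepsilon(x_{n+1})\cdots\varepsilon(x_m)\,x_1y_1\otimes\cdots\otimes x_ny_n\otimes\delta$. An element $a\in\mathscr W(X)$ is *bounded* if there is $m$ with $\varpi^ma=0$, i.e. $\varpi^ma_i=0$ for all $i$. **Evanescent elements.** Let $\deg$ on $X^{\otimes n}$ denote the total degree in the variables, with $\deg(x)=1$ (so that the maximal degree in one factor is $p-1$). For $\ell\in\mathbb N$, an element $a=(a_0,a_1,\dots)\in\mathscr W(X)$ is *$\ell$-evanescent* if each $a_i$ has the form $\sum b_i\otimes c_i\otimes\partial_x$ with $b_i\in X^{\otimes\max\{i-\ell,0\}}$, $c_i\in X^{\otimes\min\{i,\ell\}}$ and $\deg(c_i)<(p-1)\ell$ in every summand. **Nil.** A restricted Lie algebra is *nil* if for each of its elements $a$ there is $n\in\mathbb N$ with $a^{p^n}=((a^p)^p\cdots)^p=0$ (so that in particular $\mathrm{ad}(a)$ is nilpotent). *)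

theory Defs
  imports
    "HOL-Computational_Algebra.Polynomial"
    "HOL-Computational_Algebra.Primes"
    "HOL-Library.Function_Algebras"
    "HOL-Library.FuncSet"
begin

section \<open>The algebra \<open>X = k[x]/(x^p)\<close>\<close>

text \<open>The ground ring is a type \<open>'k\<close> of class \<^class>\<open>idom_prime_char\<close>, i.e. an integral domain whose
  characteristic \<open>p = CHAR('k)\<close> is positive, hence prime.\<close>

definition trunc_rel :: "'k::idom_prime_char poly \<Rightarrow> 'k poly \<Rightarrow> bool"
  where "trunc_rel f g \<longleftrightarrow> [:0, 1:] ^ CHAR('k) dvd f - g"

lemma trunc_rel_coeff:
  fixes f g :: "'k::idom_prime_char poly"
  shows "trunc_rel f g \<longleftrightarrow> (\<forall>i<CHAR('k). coeff f i = coeff g i)"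
  by (simp add: trunc_rel_def monom_1_dvd_iff' flip: monom_altdef[of 1, simplified])

lemma equivp_trunc_rel: "equivp (trunc_rel :: 'k::idom_prime_char poly \<Rightarrow> _)"
  by (rule equivpI) (auto simp: reflp_def symp_def transp_def trunc_rel_coeff)

quotient_type (overloaded) 'k trunc = "'k::idom_prime_char poly" / trunc_rel
  by (rule equivp_trunc_rel)

lemma CHAR_gt_1: "CHAR('k::idom_prime_char) > 1"
  by (rule prime_gt_1_nat) (rule CHAR_prime)

instantiation trunc :: (idom_prime_char) comm_ring_1
begin

lift_definition zero_trunc :: "'a trunc" is 0 .
lift_definition one_trunc :: "'a trunc" is 1 .
lift_definition plus_trunc :: "'a trunc \<Rightarrow> 'a trunc \<Rightarrow> 'a trunc" is plus
  by (simp add: trunc_rel_coeff)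
lift_definition minus_trunc :: "'a trunc \<Rightarrow> 'a trunc \<Rightarrow> 'a trunc" is minus
  by (simp add: trunc_rel_coeff)
lift_definition uminus_trunc :: "'a trunc \<Rightarrow> 'a trunc" is uminus
  by (simp add: trunc_rel_coeff)
lift_definition times_trunc :: "'a trunc \<Rightarrow> 'a trunc \<Rightarrow> 'a trunc" is times
  by (auto simp add: trunc_rel_coeff coeff_mult intro!: sum.cong)

instance
proof
  show "(0::'a trunc) \<noteq> 1"
    using CHAR_gt_1[where 'k='a] by transfer (auto simp: trunc_rel_coeff intro!: exI[of _ 0])
qed (transfer; simp add: algebra_simps trunc_rel_def)+

end

lift_definition tvar :: "'k::idom_prime_char trunc" is "[:0, 1:]" .

lift_definition tscale :: "'k::idom_prime_char \<Rightarrow> 'k trunc \<Rightarrow> 'k trunc" is smult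
  by (simp add: trunc_rel_coeff)

text \<open>Coefficient of \<open>x^i\<close>, where \<open>1, x, \<dots>, x^(p-1)\<close> is the basis of \<open>X\<close>.\<close>

lift_definition tcoeff :: "'k::idom_prime_char trunc \<Rightarrow> nat \<Rightarrow> 'k"
  is "\<lambda>f i. if i < CHAR('k) then coeff f i else 0"
  by (auto simp: trunc_rel_coeff fun_eq_iff)

lift_definition taug :: "'k::idom_prime_char trunc \<Rightarrow> 'k" is "\<lambda>f. poly f 0"
  by (simp add: trunc_rel_coeff poly_0_coeff_0 CHAR_pos)

lift_definition ddx :: "'k::idom_prime_char trunc \<Rightarrow> 'k trunc" is pderiv
proof -
  fix f g :: "'k poly" assume *: "trunc_rel f g"
  show "trunc_rel (pderiv f) (pderiv g)"
    unfolding trunc_rel_coeff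
  proof (intro allI impI)
    fix i assume "i < CHAR('k)"
    then consider "Suc i < CHAR('k)" | "of_nat (Suc i) = (0::'k)"
      by (metis Suc_lessI of_nat_CHAR)
    then have "of_nat (Suc i) * coeff f (Suc i) = of_nat (Suc i) * coeff g (Suc i)"
      using * by cases (auto simp: trunc_rel_coeff simp del: of_nat_Suc)
    then show "coeff (pderiv f) i = coeff (pderiv g) i"
      by (simp add: coeff_pderiv del: of_nat_Suc)
  qed
qed

lemma tcoeff_add [simp]: "tcoeff (f + g) i = tcoeff f i + tcoeff g i"
  by transfer simp
lemma tcoeff_diff [simp]: "tcoeff (f - g) i = tcoeff f i - tcoeff g i"
  by transfer simp
lemma tcoeff_0 [simp]: "tcoeff 0 i = 0"
  by transfer simp
lemma tcoeff_tscale [simp]: "tcoeff (tscale c f) i = c * tcoeff f i"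
  by transfer simp
lemma tcoeff_sum [simp]: "tcoeff (sum f A) i = (\<Sum>a\<in>A. tcoeff (f a) i)"
  by (induction A rule: infinite_finite_induct) auto
lemma tcoeff_mult:
  "tcoeff (f * g :: 'k::idom_prime_char trunc) i = (if i < CHAR('k) then \<Sum>j\<le>i. tcoeff f j * tcoeff g (i - j) else 0)"
  by transfer (auto simp: coeff_mult intro!: sum.cong)
lemma tcoeff_eqI: "(\<And>i. i < CHAR('k) \<Longrightarrow> tcoeff f i = tcoeff g i) \<Longrightarrow> f = (g :: 'k::idom_prime_char trunc)"
  by transfer (auto simp: trunc_rel_coeff)
lemma tcoeff_ge: "i \<ge> CHAR('k) \<Longrightarrow> tcoeff (f :: 'k::idom_prime_char trunc) i = 0"
  by transfer auto
lemma tcoeff_tvar_power: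
  "tcoeff (tvar ^ n :: 'k::idom_prime_char trunc) i = (if i = n \<and> i < CHAR('k) then 1 else 0)"
proof (induction n arbitrary: i)
  case 0 show ?case unfolding power_0 by transfer auto
next
  case (Suc n)
  have *: "tcoeff (tvar :: 'k trunc) j = (if j = 1 then 1 else 0)" for j
    using CHAR_gt_1[where 'k='k] by transfer (auto simp: coeff_pCons split: nat.split)
  show ?case
    by (cases i) (auto simp: tcoeff_mult Suc * if_distrib[of "\<lambda>x. x * _"] sum.delta' atMost_Suc_eq_insert_0 cong: if_cong)
qed
lemma taug_tcoeff: "taug (f :: 'k::idom_prime_char trunc) = tcoeff f 0"
  using CHAR_gt_1[where 'k='k] by transfer (auto simp: poly_0_coeff_0)

lemma module_tscale: "module tscale"
  by unfold_locales (transfer; simp add: trunc_rel_coeff algebra_simps)+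

interpretation tscale: module tscale by (rule module_tscale)

lemma tscale_mult [simp]: "tscale c f * g = tscale c (f * g)" "f * tscale c g = tscale c (f * g)"
  by (transfer; simp add: trunc_rel_coeff)+

lemma tvar_expansion: "f = (\<Sum>j<CHAR('k). tscale (tcoeff f j) (tvar ^ j))" for f :: "'k::idom_prime_char trunc"
  by (rule tcoeff_eqI) (auto simp: tcoeff_tvar_power if_distrib sum.delta cong: if_cong)

definition Der :: "('k::idom_prime_char trunc \<Rightarrow> 'k trunc) set"
  where "Der = {\<delta>. module_hom tscale tscale \<delta> \<and> (\<forall>f g. \<delta> (f * g) = \<delta> f * g + f * \<delta> g)}"

lemma ddx_in_Der: "ddx \<in> Der"
  unfolding Der_def
  by (auto intro!: module_hom.intro module_hom_axioms.intro module_tscale)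
    (transfer; simp add: trunc_rel_coeff pderiv_add pderiv_smult pderiv_mult algebra_simps)+

lemma ddx_tvar: "ddx tvar = 1"
  by transfer (simp add: trunc_rel_coeff pderiv_pCons coeff_pCons split: nat.split)

lemma Der_eq: "Der = {\<lambda>f. g * ddx f | g. True}"
proof -
  have 1: "(\<lambda>f. g * ddx f) \<in> Der" for g :: "'a trunc"
    using ddx_in_Der[where 'a='a]
    by (auto simp: Der_def module_hom_iff algebra_simps)
  have "\<delta> f = \<delta> tvar * ddx f" if "\<delta> \<in> Der" for \<delta> and f :: "'a trunc"
  proof -
    have p: "\<delta>' 1 = 0" "\<delta>' (tvar ^ j) = of_nat j * tvar ^ (j - 1) * \<delta>' tvar"
      if "\<delta>' \<in> Der" for \<delta>' and j :: nat
    proof -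
      have "\<delta>' 1 = \<delta>' 1 + \<delta>' 1" using that unfolding Der_def by (metis (mono_tags, lifting) mem_Collect_eq mult_1 mult.right_neutral)
      then show 0: "\<delta>' 1 = 0" by simp
      show "\<delta>' (tvar ^ j) = of_nat j * tvar ^ (j - 1) * \<delta>' tvar"
      proof (induction j)
        case (Suc j) then show ?case using that by (cases j) (auto simp: Der_def algebra_simps 0)
      qed (simp add: 0)
    qed
    have lin: "module_hom tscale tscale \<delta>" "module_hom tscale tscale (ddx::'a trunc \<Rightarrow> _)"
      using that ddx_in_Der by (auto simp: Der_def)
    have "\<delta>' f = (\<Sum>j<CHAR('a). tscale (tcoeff f j) (\<delta>' (tvar ^ j)))"
      if "module_hom tscale tscale \<delta>'" for \<delta>' :: "'a trunc \<Rightarrow> 'a trunc"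
    proof -
      interpret h: module_hom tscale tscale \<delta>' by fact
      have "\<delta>' f = \<delta>' (\<Sum>j<CHAR('a). tscale (tcoeff f j) (tvar ^ j))"
        by (rule arg_cong[OF tvar_expansion])
      then show ?thesis by (simp only: h.sum h.scale)
    qed
    note e = this[OF lin(1)] this[OF lin(2)]
    have "\<delta> f = \<delta> tvar * (\<Sum>j<CHAR('a). tscale (tcoeff f j) (ddx (tvar ^ j)))"
      unfolding e(1) sum_distrib_left
      by (intro sum.cong refl) (simp only: p(2)[OF that] p(2)[OF ddx_in_Der] ddx_tvar tscale_mult mult_ac mult_1)
    also have "\<dots> = \<delta> tvar * ddx f"
      by (simp only: e(2))
    finally show ?thesis .
  qed
  then have "\<delta> = (\<lambda>f. \<delta> tvar * ddx f)" if "\<delta> \<in> Der" for \<delta> :: "'a trunc \<Rightarrow> 'a trunc"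
    using that by (intro ext) simp
  with 1 show ?thesis by (intro Set.set_eqI iffI) (simp only: mem_Collect_eq, metis, clarify)
qed

section \<open>Tensor powers\<close>

text \<open>
  All modules in sight are free or tensor products with a free factor, so tensors are written in
  coordinates.  Let \<open>midx n\<close> be the set of exponents \<open>e\<close> of the monomials
  \<open>x^(e 0) \<otimes> \<dots> \<otimes> x^(e (n-1))\<close> that form the basis of \<open>X^(\<otimes> n)\<close>; exponents are extended by \<open>0\<close> beyond
  the first \<open>n\<close> positions.  For a module \<open>M\<close>, the elements of \<open>X^(\<otimes> n) \<otimes> M\<close> are the families \<open>t\<close> with
  \<open>t e \<in> M\<close> supported in \<open>midx n\<close>, where \<open>t\<close> stands for \<open>\<Sum>e. x^(e 0) \<otimes> \<dots> \<otimes> x^(e (n-1)) \<otimes> t e\<close>.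
  With this encoding the embedding \<open>v \<mapsto> v \<otimes> 1\<close> of \<open>X^(\<otimes> n)\<close> in \<open>X^(\<otimes> n+1)\<close> is the set inclusion
  (lemma \<open>pure_embed\<close>).  Tensor factors are numbered from \<open>0\<close>.
\<close>

definition midx :: "nat \<Rightarrow> nat \<Rightarrow> (nat \<Rightarrow> nat) set"
  where "midx p n = {e. (\<forall>i<n. e i < p) \<and> (\<forall>i\<ge>n. e i = 0)}"

type_synonym 'k tens = "(nat \<Rightarrow> nat) \<Rightarrow> 'k"
type_synonym 'k dtens = "(nat \<Rightarrow> nat) \<Rightarrow> 'k trunc \<Rightarrow> 'k trunc"

definition Xpow :: "nat \<Rightarrow> 'k::idom_prime_char tens set"
  where "Xpow n = {v. \<forall>e. e \<notin> midx CHAR('k) n \<longrightarrow> v e = 0}"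

definition XDer :: "nat \<Rightarrow> 'k::idom_prime_char dtens set"
  where "XDer n = {b. \<forall>e. b e \<in> Der \<and> (e \<notin> midx CHAR('k) n \<longrightarrow> b e = 0)}"

definition kscale :: "'k::idom_prime_char \<Rightarrow> 'k tens \<Rightarrow> 'k tens"
  where "kscale c v = (\<lambda>e. c * v e)"

text \<open>\<open>pure n x\<close> is \<open>x 0 \<otimes> \<dots> \<otimes> x (n-1) \<in> X^(\<otimes> n)\<close>.\<close>

definition pure :: "nat \<Rightarrow> (nat \<Rightarrow> 'k::idom_prime_char trunc) \<Rightarrow> 'k tens"
  where "pure n x = (\<lambda>e. if e \<in> midx CHAR('k) n then \<Prod>i<n. tcoeff (x i) (e i) else 0)"

text \<open>\<open>otimes m b c\<close> is \<open>b \<otimes> c \<in> X^(\<otimes> m+n)\<close> for \<open>b \<in> X^(\<otimes> m)\<close>, \<open>c \<in> X^(\<otimes> n)\<close>, and \<open>dotimes v \<delta>\<close> is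
  \<open>v \<otimes> \<delta> \<in> X^(\<otimes> n) \<otimes> Der X\<close> for \<open>v \<in> X^(\<otimes> n)\<close>, \<open>\<delta> \<in> Der X\<close>.\<close>

definition otimes :: "nat \<Rightarrow> 'k::idom_prime_char tens \<Rightarrow> 'k tens \<Rightarrow> 'k tens"
  where "otimes m b c = (\<lambda>e. b (\<lambda>i. if i < m then e i else 0) * c (\<lambda>i. e (i + m)))"

definition dotimes :: "'k::idom_prime_char tens \<Rightarrow> ('k trunc \<Rightarrow> 'k trunc) \<Rightarrow> 'k dtens"
  where "dotimes v \<delta> = (\<lambda>e f. tscale (v e) (\<delta> f))"

definition multilinear ::
  "nat \<Rightarrow> ('k::idom_prime_char \<Rightarrow> 'b::ab_group_add \<Rightarrow> 'b) \<Rightarrow> ((nat \<Rightarrow> 'k trunc) \<Rightarrow> 'b) \<Rightarrow> bool"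
  where "multilinear n s \<phi> \<longleftrightarrow>
    (\<forall>i<n. \<forall>x. module_hom tscale s (\<lambda>y. \<phi> (x(i := y)))) \<and>
    (\<forall>x y. (\<forall>i<n. x i = y i) \<longrightarrow> \<phi> x = \<phi> y)"

lemma midx_0: "midx p 0 = {\<lambda>_. 0}"
  by (auto simp: midx_def)

lemma midx_Suc_bij: "bij_betw (\<lambda>(e, j). e(n := j)) (midx p n \<times> {..<p}) (midx p (Suc n))"
proof (rule bij_betw_byWitness[where f' = "\<lambda>e. (e(n := 0), e n)"])
  show "\<forall>a\<in>midx p n \<times> {..<p}. (\<lambda>e. (e(n := 0), e n)) ((\<lambda>(e, j). e(n := j)) a) = a"
    by (auto simp: midx_def fun_eq_iff)
qed (auto simp: midx_def)

lemma finite_midx [simp]: "finite (midx p n)"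
  by (induction n) (auto simp: midx_0 bij_betw_finite[OF midx_Suc_bij, symmetric])

lemma sum_midx_Suc: "(\<Sum>e\<in>midx p (Suc n). f e) = (\<Sum>e\<in>midx p n. \<Sum>j<p. f (e(n := j)))"
  by (simp add: sum.reindex_bij_betw[OF midx_Suc_bij, symmetric] sum.cartesian_product case_prod_unfold)

lemma midx_mono: "m \<le> n \<Longrightarrow> 0 < p \<Longrightarrow> midx p m \<subseteq> midx p n"
  by (auto simp: midx_def) (metis not_le)

lemma sum_fun_apply: "(sum f A) x = (\<Sum>a\<in>A. f a x)" for f :: "_ \<Rightarrow> _ \<Rightarrow> 'b::comm_monoid_add"
  by (induction A rule: infinite_finite_induct) auto

lemma module_kscale: "module kscale"
  by unfold_locales (auto simp: kscale_def fun_eq_iff algebra_simps)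

interpretation kscale: module kscale by (rule module_kscale)

lemma kscale_apply: "kscale c v e = c * v e"
  by (simp add: kscale_def)

lemma multilinear_expansion:
  fixes \<phi> :: "(nat \<Rightarrow> 'k::idom_prime_char trunc) \<Rightarrow> 'b::ab_group_add"
  assumes "multilinear n s \<phi>" "module s"
  shows "\<phi> x = (\<Sum>e\<in>midx CHAR('k) n. s (\<Prod>i<n. tcoeff (x i) (e i)) (\<phi> (\<lambda>i. tvar ^ e i)))"
proof -
  interpret s: module s by fact
  have cong: "\<phi> x = \<phi> y" if "\<And>i. i < n \<Longrightarrow> x i = y i" for x y
    using assms that by (auto simp: multilinear_def)
  have "m \<le> n \<Longrightarrow> \<phi> x = (\<Sum>e\<in>midx CHAR('k) m. s (\<Prod>i<m. tcoeff (x i) (e i))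
      (\<phi> (\<lambda>i. if i < m then tvar ^ e i else x i)))" for m
  proof (induction m)
    case 0 show ?case by (simp add: midx_0)
  next
    case (Suc m)
    have "\<phi> (\<lambda>i. if i < m then tvar ^ e i else x i) =
      (\<Sum>j<CHAR('k). s (tcoeff (x m) j) (\<phi> (\<lambda>i. if i < Suc m then tvar ^ (e(m := j)) i else x i)))"
      (is "?l = ?r") for e
    proof -
      let ?y = "\<lambda>i. if i < m then tvar ^ e i else x i"
      interpret h: module_hom tscale s "\<lambda>y. \<phi> (?y(m := y))"
        using assms Suc.prems by (auto simp: multilinear_def)
      have "?l = \<phi> (?y(m := x m))" by (rule cong) auto
      also have "\<dots> = \<phi> (?y(m := (\<Sum>j<CHAR('k). tscale (tcoeff (x m) j) (tvar ^ j))))"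
        by (subst tvar_expansion[of "x m"]) (rule refl)
      also have "\<dots> = (\<Sum>j<CHAR('k). s (tcoeff (x m) j) (\<phi> (?y(m := tvar ^ j))))"
        by (simp only: h.sum h.scale)
      also have "\<dots> = ?r"
        by (intro sum.cong refl arg_cong2[where f = s] cong) (auto simp: less_Suc_eq)
      finally show ?thesis .
    qed
    with Suc show ?case
      by (simp add: sum_midx_Suc s.scale_sum_right mult.commute)
  qed
  from this[of n] show ?thesis
    by (simp cong: cong sum.cong)
qed

lemma multilinear_pure: "multilinear n kscale (pure n)"
  unfolding multilinear_def module_hom_iff
proof (intro conjI allI impI module_tscale module_kscale)
  fix i and x :: "nat \<Rightarrow> 'a trunc" and y z c assume "i < n"
  have *: "(\<Prod>j<n. tcoeff ((x(i := y)) j) (e j)) = tcoeff y (e i) * (\<Prod>j\<in>{..<n}-{i}. tcoeff (x j) (e j))" for y e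
    using \<open>i < n\<close> by (subst prod.remove[of _ i]) auto
  show "pure n (x(i := y + z)) = pure n (x(i := y)) + pure n (x(i := z))"
    by (simp only: pure_def fun_eq_iff *) (simp add: algebra_simps)
  show "pure n (x(i := tscale c y)) = kscale c (pure n (x(i := y)))"
    by (simp only: pure_def fun_eq_iff * kscale_def) (simp add: algebra_simps)
qed (auto simp: pure_def fun_eq_iff)

lemma pure_in_Xpow [simp]: "pure n x \<in> Xpow n"
  by (auto simp: pure_def Xpow_def)

lemma pure_cong: "(\<And>i. i < n \<Longrightarrow> x i = y i) \<Longrightarrow> pure n x = pure n y"
  using multilinear_pure[of n] unfolding multilinear_def by blast

lemma pure_mono_apply:
  fixes e :: "nat \<Rightarrow> nat"
  assumes "e \<in> midx CHAR('k) n"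
  shows "pure n (\<lambda>i. tvar ^ e i :: 'k::idom_prime_char trunc) e' = (if e' = e then 1 else 0)"
proof (cases "e' \<in> midx CHAR('k) n")
  case True
  have "(\<Prod>i<n. tcoeff (tvar ^ e i :: 'k trunc) (e' i)) = (if \<forall>i<n. e' i = e i then 1 else 0)"
    using True by (auto simp: tcoeff_tvar_power midx_def)
  moreover have "(\<forall>i<n. e' i = e i) \<longleftrightarrow> e' = e"
    using True assms unfolding midx_def fun_eq_iff mem_Collect_eq by (metis not_le)
  ultimately show ?thesis using True by (simp add: pure_def)
qed (use assms in \<open>auto simp: pure_def\<close>)

lemma Xpow_expansion:
  assumes "(v :: 'k::idom_prime_char tens) \<in> Xpow n"
  shows "v = (\<Sum>e\<in>midx CHAR('k) n. kscale (v e) (pure n (\<lambda>i. tvar ^ e i)))"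
proof
  fix e
  show "v e = (\<Sum>e\<in>midx CHAR('k) n. kscale (v e) (pure n (\<lambda>i. tvar ^ e i))) e"
    using assms
    by (auto simp: sum_fun_apply kscale_apply pure_mono_apply Xpow_def if_distrib[of "\<lambda>x. _ * x"] sum.delta cong: sum.cong if_cong)
qed

lemma subspace_Xpow: "kscale.subspace (Xpow n)"
  by (auto simp: kscale.subspace_def Xpow_def kscale_def)

text \<open>\<open>Xpow n\<close> with \<open>pure n\<close> has the universal property of the \<open>n\<close>-th tensor power of \<open>X\<close>.\<close>

lemma Xpow_span: "Xpow n = kscale.span (range (pure n))"
proof (intro subset_antisym subsetI)
  fix v assume "v \<in> Xpow n"
  from Xpow_expansion[OF this] show "v \<in> kscale.span (range (pure n))"
    by (rule ssubst[where P = "\<lambda>v. v \<in> kscale.span (range (pure n))"])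
      (intro kscale.span_sum kscale.span_scale kscale.span_base rangeI)
next
  fix v assume "v \<in> kscale.span (range (pure n))"
  moreover have "kscale.span (range (pure n)) \<subseteq> Xpow n"
    by (rule kscale.span_minimal) (auto simp: subspace_Xpow)
  ultimately show "v \<in> Xpow n" by blast
qed

lemma Xpow_universal:
  fixes \<phi> :: "(nat \<Rightarrow> 'k::idom_prime_char trunc) \<Rightarrow> 'b::ab_group_add"
  assumes "multilinear n s \<phi>" "module s"
  shows "\<exists>\<Phi>. module_hom kscale s \<Phi> \<and> (\<forall>x. \<Phi> (pure n x) = \<phi> x)"
proof -
  interpret s: module s by fact
  let ?\<Phi> = "\<lambda>v. \<Sum>e\<in>midx CHAR('k) n. s (v e) (\<phi> (\<lambda>i. tvar ^ e i))"
  have "module_hom kscale s ?\<Phi>"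
    using assms(2) module_kscale
    by (auto simp: module_hom_iff s.scale_left_distrib sum.distrib kscale_apply s.scale_sum_right)
  moreover have "?\<Phi> (pure n x) = \<phi> x" for x
    by (subst (2) multilinear_expansion[OF assms]) (auto simp: pure_def intro!: sum.cong)
  ultimately show ?thesis by blast
qed

lemma pure_embed:
  fixes x :: "nat \<Rightarrow> 'k::idom_prime_char trunc"
  shows "pure (Suc n) (x(n := 1)) = pure n x"
proof
  fix e
  have 1: "tcoeff (1 :: 'k trunc) j = (if j = 0 then 1 else 0)" for j
    using tcoeff_tvar_power[of 0 j, where 'k='k] CHAR_pos[where 'a='k] by auto
  have m: "e \<in> midx CHAR('k) (Suc n) \<and> e n = 0 \<longleftrightarrow> e \<in> midx CHAR('k) n"
    using CHAR_pos[where 'a='k] by (auto simp: midx_def less_Suc_eq Suc_le_eq) (metis le_neq_implies_less)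
  show "pure (Suc n) (x(n := 1)) e = pure n x e"
    using m by (auto simp: pure_def 1)
qed

lemma otimes_pure:
  fixes x :: "nat \<Rightarrow> 'k::idom_prime_char trunc"
  shows "otimes m (pure m x) (pure n y) = pure (m + n) (\<lambda>i. if i < m then x i else y (i - m))"
  (is "?l = ?r")
proof
  fix e
  have m: "(\<lambda>i. if i < m then e i else 0) \<in> midx CHAR('k) m \<and> (\<lambda>i. e (i + m)) \<in> midx CHAR('k) n
      \<longleftrightarrow> e \<in> midx CHAR('k) (m + n)" (is "?L \<longleftrightarrow> ?R")
  proof
    assume L: ?L
    show ?R unfolding midx_def
    proof (safe)
      fix i assume "i < m + n" then show "e i < CHAR('k)"
        using L by (cases "i < m") (auto simp: midx_def dest!: spec[of _ "i - m"] split: if_splits)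
    next
      fix i assume "m + n \<le> i" then show "e i = 0"
        using L by (auto simp: midx_def dest!: spec[of _ "i - m"])
    qed
  qed (auto simp: midx_def)
  have p: "(\<Prod>i<m+n. f i) = (\<Prod>i<m. f i) * (\<Prod>i<n. f (i + m))" for f :: "nat \<Rightarrow> 'k"
    by (induction n) (auto simp: add_ac)
  show "?l e = ?r e"
    using m by (auto simp: otimes_def pure_def p)
qed
text \<open>Likewise \<open>XDer n\<close> with \<open>dotimes\<close> has the universal property of \<open>X^(\<otimes> n) \<otimes> Der X\<close>.\<close>

lemma Der_closed:
  assumes "\<delta> \<in> Der" "\<delta>' \<in> Der"
  shows "0 \<in> Der" "\<delta> + \<delta>' \<in> Der" "(\<lambda>f. tscale c (\<delta> f)) \<in> Der"
  using assms by (auto simp: Der_def module_hom_iff module_tscale algebra_simps)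

lemma dotimes_in_XDer: "v \<in> Xpow n \<Longrightarrow> \<delta> \<in> Der \<Longrightarrow> dotimes v \<delta> \<in> XDer n"
  by (auto simp: XDer_def Xpow_def dotimes_def Der_def module_hom_iff algebra_simps fun_eq_iff)

lemma XDer_expansion:
  assumes "(b :: 'k::idom_prime_char dtens) \<in> XDer n"
  shows "b = (\<Sum>e\<in>midx CHAR('k) n. dotimes (pure n (\<lambda>i. tvar ^ e i)) (b e))"
proof (intro ext)
  fix e f
  show "b e f = (\<Sum>e\<in>midx CHAR('k) n. dotimes (pure n (\<lambda>i. tvar ^ e i)) (b e)) e f"
    using assms
    by (auto simp: sum_fun_apply dotimes_def pure_mono_apply XDer_def if_distrib[of "\<lambda>x. tscale x _"]
      sum.delta cong: sum.cong if_cong)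
qed

lemma XDer_universal:
  fixes \<beta> :: "'k::idom_prime_char tens \<Rightarrow> ('k trunc \<Rightarrow> 'k trunc) \<Rightarrow> 'b::ab_group_add"
  assumes s: "module s"
    and left: "\<And>\<delta>. \<delta> \<in> Der \<Longrightarrow> module_hom kscale s (\<lambda>v. \<beta> v \<delta>)"
    and add: "\<And>v \<delta> \<delta>'. \<delta> \<in> Der \<Longrightarrow> \<delta>' \<in> Der \<Longrightarrow> \<beta> v (\<delta> + \<delta>') = \<beta> v \<delta> + \<beta> v \<delta>'"
    and scale: "\<And>v \<delta> c. \<delta> \<in> Der \<Longrightarrow> \<beta> v (\<lambda>f. tscale c (\<delta> f)) = s c (\<beta> v \<delta>)"
  shows "\<exists>\<Phi>. (\<forall>b\<in>XDer n. \<forall>b'\<in>XDer n. \<Phi> (b + b') = \<Phi> b + \<Phi> b') \<and>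
    (\<forall>c. \<forall>b\<in>XDer n. \<Phi> (\<lambda>e f. tscale c (b e f)) = s c (\<Phi> b)) \<and>
    (\<forall>v\<in>Xpow n. \<forall>\<delta>\<in>Der. \<Phi> (dotimes v \<delta>) = \<beta> v \<delta>)"
proof -
  interpret s: module s by fact
  let ?\<Phi> = "\<lambda>b. \<Sum>e\<in>midx CHAR('k) n. \<beta> (pure n (\<lambda>i. tvar ^ e i)) (b e)"
  have "?\<Phi> (b + b') = ?\<Phi> b + ?\<Phi> b'" if "b \<in> XDer n" "b' \<in> XDer n" for b b'
    using that by (simp add: add XDer_def sum.distrib)
  moreover have "?\<Phi> (\<lambda>e f. tscale c (b e f)) = s c (?\<Phi> b)" if "b \<in> XDer n" for c b
    using that by (simp add: scale XDer_def s.scale_sum_right)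
  moreover have "?\<Phi> (dotimes v \<delta>) = \<beta> v \<delta>" if v: "v \<in> Xpow n" and \<delta>: "\<delta> \<in> Der" for v \<delta>
  proof -
    interpret h: module_hom kscale s "\<lambda>v. \<beta> v \<delta>" by (rule left[OF \<delta>])
    have "\<beta> v \<delta> = \<beta> (\<Sum>e\<in>midx CHAR('k) n. kscale (v e) (pure n (\<lambda>i. tvar ^ e i))) \<delta>"
      by (rule arg_cong[OF Xpow_expansion[OF v]])
    then show ?thesis by (simp add: h.sum h.scale dotimes_def scale[OF \<delta>])
  qed
  ultimately show ?thesis by (intro exI[of _ ?\<Phi>] conjI ballI allI) assumption+
qed

section \<open>The algebra \<open>W(X)\<close>\<close>

text \<open>\<open>a n\<close> is the component \<open>a_n \<in> X^(\<otimes> n) \<otimes> Der X\<close> of \<open>a \<in> W(X)\<close>; likewise \<open>v k \<in> X^(\<otimes> k)\<close> for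
  \<open>v \<in> T(X)\<close>.\<close>

type_synonym 'k wel = "nat \<Rightarrow> 'k dtens"

definition WX :: "'k::idom_prime_char wel set"
  where "WX = {a. \<forall>n. a n \<in> XDer n}"

definition TX :: "(nat \<Rightarrow> 'k::idom_prime_char tens) set"
  where "TX = {v. (\<forall>k. v k \<in> Xpow k) \<and> finite {k. v k \<noteq> 0}}"

text \<open>The action of \<open>b \<in> X^(\<otimes> n) \<otimes> Der X\<close> on \<open>v \<in> X^(\<otimes> k)\<close> for \<open>n < k\<close>, extended bilinearly from basis
  tensors; lemma \<open>hact_pure\<close> below gives it on arbitrary pure tensors.\<close>

definition hact :: "nat \<Rightarrow> 'k::idom_prime_char dtens \<Rightarrow> nat \<Rightarrow> 'k tens \<Rightarrow> 'k tens"
  where "hact n b k v =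
    (\<Sum>e\<in>midx CHAR('k) n. \<Sum>f\<in>midx CHAR('k) k. kscale (v f) (pure k
      (\<lambda>i. if i < n then tvar ^ e i * tvar ^ f i else if i = n then b e (tvar ^ f i) else tvar ^ f i)))"

definition act :: "'k::idom_prime_char wel \<Rightarrow> (nat \<Rightarrow> 'k tens) \<Rightarrow> nat \<Rightarrow> 'k tens"
  where "act a v = (\<lambda>k. \<Sum>n<k. hact n (a n) k (v k))"

text \<open>The bracket and the \<open>p\<close>-mapping are those of the endomorphisms of \<open>T(X)\<close>. By lemmas
  \<open>bracket_act\<close> and \<open>ppow_act\<close> the elements described here exist and are unique.\<close>

definition bracket :: "'k::idom_prime_char wel \<Rightarrow> 'k wel \<Rightarrow> 'k wel"
  where "bracket a b = (THE c. c \<in> WX \<and> (\<forall>v\<in>TX. act c v = act a (act b v) - act b (act a v)))"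

definition ppow :: "'k::idom_prime_char wel \<Rightarrow> 'k wel"
  where "ppow a = (THE c. c \<in> WX \<and> (\<forall>v\<in>TX. act c v = (act a ^^ CHAR('k)) v))"

definition wscale :: "'k::idom_prime_char \<Rightarrow> 'k wel \<Rightarrow> 'k wel"
  where "wscale c a = (\<lambda>n e f. tscale c (a n e f))"

definition restricted_subalgebra :: "'k::idom_prime_char wel set \<Rightarrow> bool"
  where "restricted_subalgebra L \<longleftrightarrow> L \<subseteq> WX \<and> 0 \<in> L \<and>
    (\<forall>a\<in>L. \<forall>b\<in>L. a + b \<in> L) \<and> (\<forall>c. \<forall>a\<in>L. wscale c a \<in> L) \<and>
    (\<forall>a\<in>L. \<forall>b\<in>L. bracket a b \<in> L) \<and> (\<forall>a\<in>L. ppow a \<in> L)"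

definition nil_algebra :: "'k::idom_prime_char wel set \<Rightarrow> bool"
  where "nil_algebra L \<longleftrightarrow> (\<forall>a\<in>L. \<exists>n. (ppow ^^ n) a = 0)"

section \<open>Bounded elements\<close>

text \<open>The algebra \<open>R(X)\<close> is the union of the \<open>X^(\<otimes> n)\<close>, with componentwise multiplication. Note that
  \<open>{..e}\<close> and \<open>e - f\<close> refer to the pointwise order and subtraction of exponents.\<close>

definition RX :: "'k::idom_prime_char tens set"
  where "RX = (\<Union>n. Xpow n)"

definition rmult :: "'k::idom_prime_char tens \<Rightarrow> 'k tens \<Rightarrow> 'k tens"
  where "rmult f g = (\<lambda>e. if e \<in> (\<Union>n. midx CHAR('k) n) then \<Sum>d\<in>{..e}. f d * g (e - d) else 0)"

definition raug :: "'k::idom_prime_char tens \<Rightarrow> 'k"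
  where "raug f = f (\<lambda>_. 0)"

definition varpi :: "'k::idom_prime_char tens set"
  where "varpi = {f \<in> RX. raug f = 0}"

fun varpi_power :: "nat \<Rightarrow> 'k::idom_prime_char tens set"
  where
    "varpi_power 0 = RX"
  | "varpi_power (Suc m) = kscale.span {rmult f g | f g. f \<in> varpi \<and> g \<in> varpi_power m}"

text \<open>The action of \<open>f \<in> R(X)\<close> on \<open>b \<in> X^(\<otimes> n) \<otimes> Der X\<close>; see lemma \<open>ract_pure\<close>. Monomials of \<open>f\<close> that
  involve a tensor factor with index \<open>\<ge> n\<close> are killed by the augmentation there, so that only \<open>f d\<close>
  with \<open>d \<in> midx n\<close> contribute.\<close>

definition ract :: "'k::idom_prime_char tens \<Rightarrow> nat \<Rightarrow> 'k dtens \<Rightarrow> 'k dtens"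
  where "ract f n b = (\<lambda>e x. if e \<in> midx CHAR('k) n then \<Sum>d\<in>{..e}. tscale (f d) (b (e - d) x) else 0)"

definition bounded_elt :: "'k::idom_prime_char wel \<Rightarrow> bool"
  where "bounded_elt a \<longleftrightarrow> (\<exists>m. \<forall>f\<in>varpi_power m. \<forall>i. ract f i (a i) = 0)"

section \<open>Evanescent elements\<close>

text \<open>\<open>deg_less n c d\<close> says that \<open>c \<in> X^(\<otimes> n)\<close> has total degree less than \<open>d\<close>, where \<open>0\<close> has degree
  \<open>-\<infinity>\<close>.\<close>

definition deg_less :: "nat \<Rightarrow> 'k::idom_prime_char tens \<Rightarrow> nat \<Rightarrow> bool"
  where "deg_less n c d \<longleftrightarrow> (\<forall>e. c e \<noteq> 0 \<longrightarrow> (\<Sum>i<n. e i) < d)"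

text \<open>Truncated subtraction gives \<open>i - l = max (i - l) 0\<close>.\<close>

definition evanescent :: "nat \<Rightarrow> 'k::idom_prime_char wel \<Rightarrow> bool"
  where "evanescent l a \<longleftrightarrow> (\<forall>i. \<exists>bcs.
    (\<forall>(b, c)\<in>set bcs. b \<in> Xpow (i - l) \<and> c \<in> Xpow (min i l) \<and>
      deg_less (min i l) c ((CHAR('k) - 1) * l)) \<and>
    a i = (\<Sum>(b, c)\<leftarrow>bcs. dotimes (otimes (i - l) b c) ddx))"

section \<open>Consistency of the definitions\<close>

text \<open>The multiplication of \<open>R(X)\<close> and its actions on pure tensors.\<close>

lemma rmult_add_left: "rmult (f + g) h = rmult f h + rmult g h"
  and rmult_add_right: "rmult h (f + g) = rmult h f + rmult h g"
  and rmult_scale_left: "rmult (kscale c f) h = kscale c (rmult f h)"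
  and rmult_scale_right: "rmult h (kscale c f) = kscale c (rmult h f)"
  by (auto simp: rmult_def fun_eq_iff kscale_def algebra_simps sum.distrib sum_distrib_left)

lemma rmult_0_left: "rmult 0 h = 0" and rmult_0_right: "rmult h 0 = 0"
  by (auto simp: rmult_def fun_eq_iff)

lemma finite_atMost_midx: "e \<in> midx p n \<Longrightarrow> finite {..e}"
  by (rule finite_subset[OF _ finite_midx[of p n]])
    (fastforce simp: midx_def le_fun_def intro: le_less_trans)

lemma sum_atMost_midx:
  fixes f g :: "nat \<Rightarrow> nat \<Rightarrow> 'b::comm_ring_1"
  assumes "e \<in> midx p n"
  shows "(\<Sum>d\<in>{..e}. (\<Prod>i<n. f i (d i)) * (\<Prod>i<n. g i ((e - d) i))) = (\<Prod>i<n. \<Sum>j\<le>e i. f i j * g i (e i - j))"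
proof -
  have "(\<Prod>i<n. \<Sum>j\<le>e i. f i j * g i (e i - j)) =
      (\<Sum>h\<in>PiE {..<n} (\<lambda>i. {..e i}). \<Prod>i<n. f i (h i) * g i (e i - h i))"
    by (rule prod_sum_PiE) auto
  also have "\<dots> = (\<Sum>d\<in>{..e}. \<Prod>i<n. f i (d i) * g i ((e - d) i))"
  proof (rule sum.reindex_bij_witness[where j = "\<lambda>h i. if i < n then h i else 0" and i = "\<lambda>d. restrict d {..<n}"])
    fix h assume "h \<in> PiE {..<n} (\<lambda>i. {..e i})"
    then show "restrict (\<lambda>i. if i < n then h i else 0) {..<n} = h"
      by (auto simp: fun_eq_iff PiE_def extensional_def)
  next
    fix d assume "d \<in> {..e}"
    then have "d i = 0" if "i \<ge> n" for i
      using assms that le_funD[of d e i] by (simp add: midx_def)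
    then show "(\<lambda>i. if i < n then restrict d {..<n} i else 0) = d"
      by (auto simp: fun_eq_iff)
  qed (auto simp: le_fun_def)
  finally show ?thesis by (simp add: prod.distrib)
qed

lemma rmult_pure: "rmult (pure n x) (pure n y) = pure n (\<lambda>i. x i * y i)"
proof
  fix e :: "nat \<Rightarrow> nat"
  let ?p = "CHAR('a)"
  consider "e \<in> midx ?p n" | "e \<notin> midx ?p n" "e \<in> (\<Union>n. midx ?p n)" | "e \<notin> (\<Union>n. midx ?p n)" by blast
  then show "rmult (pure n x) (pure n y) e = pure n (\<lambda>i. x i * y i) e"
  proof cases
    case 1
    have *: "d \<in> midx ?p n" "e - d \<in> midx ?p n" if "d \<le> e" for d
      using that 1 by (auto simp: midx_def le_fun_def intro: le_less_trans)
        (metis bot_nat_0.extremum_uniqueI)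
    have "rmult (pure n x) (pure n y) e =
      (\<Sum>d\<in>{..e}. (\<Prod>i<n. tcoeff (x i) (d i)) * (\<Prod>i<n. tcoeff (y i) ((e - d) i)))"
      using 1 * by (auto simp: rmult_def pure_def intro!: sum.cong)
    also have "\<dots> = (\<Prod>i<n. \<Sum>j\<le>e i. tcoeff (x i) j * tcoeff (y i) (e i - j))"
      by (rule sum_atMost_midx[OF 1])
    finally show ?thesis
      using 1 by (auto simp: pure_def tcoeff_mult midx_def intro!: prod.cong)
  next
    case 2
    then obtain N where N: "e \<in> midx ?p N" by blast
    have bd: "e i < ?p" for i
      using N CHAR_pos[where 'a='a] by (cases "i < N") (simp_all add: midx_def)
    with 2(1) obtain i where i: "i \<ge> n" "e i \<noteq> 0" unfolding midx_def by blast
    have "d \<notin> midx ?p n \<or> e - d \<notin> midx ?p n" for d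
      using i by (auto simp: midx_def)
    then have "pure n x d * pure n y (e - d) = 0" for d
      by (auto simp: pure_def)
    then have "rmult (pure n x) (pure n y) e = 0"
      by (simp only: rmult_def sum.neutral_const if_cancel)
    then show ?thesis using 2 by (simp add: pure_def)
  next
    case 3 then show ?thesis by (auto simp: rmult_def pure_def)
  qed
qed

lemma raug_pure: "raug (pure n x) = (\<Prod>i<n. taug (x i))"
  by (simp add: raug_def pure_def midx_def taug_tcoeff)

lemma ract_pure:
  fixes x y :: "nat \<Rightarrow> 'k::idom_prime_char trunc"
  assumes "n \<le> m"
  shows "ract (pure m x) n (dotimes (pure n y) \<delta>) =
    dotimes (kscale (\<Prod>i=n..<m. taug (x i)) (pure n (\<lambda>i. x i * y i))) \<delta>"
proof (intro ext)
  fix e f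
  show "ract (pure m x) n (dotimes (pure n y) \<delta>) e f =
    dotimes (kscale (\<Prod>i=n..<m. taug (x i)) (pure n (\<lambda>i. x i * y i))) \<delta> e f"
  proof (cases "e \<in> midx CHAR('k) n")
    case True
    have *: "d \<in> midx CHAR('k) n" "e - d \<in> midx CHAR('k) n" if "d \<le> e" for d
      using that True by (auto simp: midx_def le_fun_def intro: le_less_trans)
        (metis bot_nat_0.extremum_uniqueI)
    have **: "pure m x d = (\<Prod>i=n..<m. taug (x i)) * pure n x d" if "d \<le> e" for d
    proof -
      have "{..<m} = {..<n} \<union> {n..<m}" using assms by auto
      then have "pure m x d = (\<Prod>i<n. tcoeff (x i) (d i)) * (\<Prod>i=n..<m. tcoeff (x i) (d i))"
        using *(1)[OF that] midx_mono[OF assms CHAR_pos[where 'a='k]]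
        by (auto simp: pure_def intro!: prod.union_disjoint)
      also have "(\<Prod>i=n..<m. tcoeff (x i) (d i)) = (\<Prod>i=n..<m. taug (x i))"
        using *(1)[OF that] by (auto simp: taug_tcoeff midx_def intro!: prod.cong)
      finally show ?thesis using *(1)[OF that] by (simp add: pure_def)
    qed
    have "ract (pure m x) n (dotimes (pure n y) \<delta>) e f =
      tscale (\<Sum>d\<in>{..e}. pure m x d * pure n y (e - d)) (\<delta> f)"
      using True by (simp add: ract_def dotimes_def tscale.scale_sum_left)
    also have "(\<Sum>d\<in>{..e}. pure m x d * pure n y (e - d)) =
      (\<Prod>i=n..<m. taug (x i)) * (\<Sum>d\<in>{..e}. pure n x d * pure n y (e - d))"
      by (simp add: sum_distrib_left ** mult_ac)
    also have "(\<Sum>d\<in>{..e}. pure n x d * pure n y (e - d)) = rmult (pure n x) (pure n y) e"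
      using True by (auto simp: rmult_def)
    finally show ?thesis by (simp add: rmult_pure dotimes_def kscale_apply)
  qed (simp add: ract_def dotimes_def kscale_def pure_def)
qed

lemma module_hom_comp: "module_hom r s f \<Longrightarrow> module_hom s t g \<Longrightarrow> module_hom r t (\<lambda>x. g (f x))"
  by (auto simp: module_hom_iff)

definition mact ::
  "nat \<Rightarrow> (nat \<Rightarrow> 'k::idom_prime_char trunc) \<Rightarrow> ('k trunc \<Rightarrow> 'k trunc) \<Rightarrow> nat \<Rightarrow> (nat \<Rightarrow> 'k trunc) \<Rightarrow> 'k tens"
  where "mact n x \<delta> k v = pure k (\<lambda>i. if i < n then x i * v i else if i = n then \<delta> (v i) else v i)"

lemma Der_hom: "\<delta> \<in> Der \<Longrightarrow> module_hom tscale tscale \<delta>"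
  by (simp add: Der_def)

lemma module_hom_pure_slot: "i < k \<Longrightarrow> module_hom tscale kscale (\<lambda>y. pure k (x(i := y)))"
  using multilinear_pure[of k] unfolding multilinear_def by blast

lemma module_hom_times: "module_hom tscale tscale ((*) x)"
  by (auto simp: module_hom_iff module_tscale algebra_simps)

lemma module_hom_times': "module_hom tscale tscale (\<lambda>y. y * x)"
  by (auto simp: module_hom_iff module_tscale algebra_simps)

lemma multilinear_mact_right:
  assumes "\<delta> \<in> Der"
  shows "multilinear k kscale (mact n x \<delta> k)"
  unfolding multilinear_def
proof (intro conjI allI impI)
  fix j and v :: "nat \<Rightarrow> 'a trunc" assume j: "j < k"
  let ?h = "if j < n then (*) (x j) else if j = n then \<delta> else (\<lambda>x. x)"
  have "module_hom tscale tscale ?h"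
    using Der_hom[OF assms] module_hom_times[of "x j"] by (auto simp: module_hom_iff module_tscale)
  note h = module_hom_comp[OF this module_hom_pure_slot[OF j]]
  have "mact n x \<delta> k (v(j := y)) =
    pure k ((\<lambda>i. if i < n then x i * v i else if i = n then \<delta> (v i) else v i)(j := ?h y))" for y
    unfolding mact_def by (rule pure_cong) auto
  then show "module_hom tscale kscale (\<lambda>y. mact n x \<delta> k (v(j := y)))"
    by (simp only: h)
qed (auto simp: mact_def intro!: pure_cong)

lemma multilinear_mact_left:
  assumes "n < k"
  shows "multilinear n kscale (\<lambda>x. mact n x \<delta> k v)"
  unfolding multilinear_def
proof (intro conjI allI impI)
  fix j and x :: "nat \<Rightarrow> 'a trunc" assume j: "j < n"
  have "mact n (x(j := y)) \<delta> k v =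
    pure k ((\<lambda>i. if i < n then x i * v i else if i = n then \<delta> (v i) else v i)(j := y * v j))" for y
    unfolding mact_def using j by (intro pure_cong) auto
  moreover have "j < k" using j assms by simp
  note module_hom_comp[OF module_hom_times' module_hom_pure_slot[OF this]]
  ultimately show "module_hom tscale kscale (\<lambda>y. mact n (x(j := y)) \<delta> k v)"
    by (simp only:)
qed (auto simp: mact_def intro!: pure_cong)

lemma mact_scale:
  assumes "n < k"
  shows "mact n x (\<lambda>f. tscale c (\<delta> f)) k v = kscale c (mact n x \<delta> k v)"
proof -
  let ?w = "\<lambda>i. if i < n then x i * v i else v i"
  interpret h: module_hom tscale kscale "\<lambda>y. pure k (?w(n := y))"
    by (rule module_hom_pure_slot[OF assms])
  have "mact n x \<delta> k v = pure k (?w(n := \<delta> (v n)))" for \<delta>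
    unfolding mact_def by (rule pure_cong) auto
  then show ?thesis by (simp only: h.scale)
qed

lemma hact_mact:
  "hact n b k v = (\<Sum>e\<in>midx CHAR('k) n. \<Sum>f\<in>midx CHAR('k) k.
    kscale (v f) (mact n (\<lambda>i. tvar ^ e i) (b e) k (\<lambda>i. tvar ^ f i)))"
  for b :: "'k::idom_prime_char dtens"
  unfolding hact_def mact_def by (intro sum.cong refl arg_cong2[where f = kscale] pure_cong)

lemma hact_pure':
  fixes b :: "'k::idom_prime_char dtens"
  assumes "b \<in> XDer n"
  shows "hact n b k (pure k v) = (\<Sum>e\<in>midx CHAR('k) n. mact n (\<lambda>i. tvar ^ e i) (b e) k v)"
  unfolding hact_mact
proof (intro sum.cong refl)
  fix e
  have "b e \<in> Der" using assms by (auto simp: XDer_def)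
  from multilinear_expansion[where \<phi> = "mact n (\<lambda>i. tvar ^ e i) (b e) k" and x = v,
    OF multilinear_mact_right[OF this] module_kscale]
  show "(\<Sum>f\<in>midx CHAR('k) k. kscale (pure k v f) (mact n (\<lambda>i. tvar ^ e i) (b e) k (\<lambda>i. tvar ^ f i))) =
    mact n (\<lambda>i. tvar ^ e i) (b e) k v"
    by (simp add: pure_def)
qed

lemma hact_pure:
  fixes x v :: "nat \<Rightarrow> 'k::idom_prime_char trunc"
  assumes "\<delta> \<in> Der" "n < k"
  shows "hact n (dotimes (pure n x) \<delta>) k (pure k v) =
    pure k (\<lambda>i. if i < n then x i * v i else if i = n then \<delta> (v i) else v i)"
proof -
  have "hact n (dotimes (pure n x) \<delta>) k (pure k v) =
    (\<Sum>e\<in>midx CHAR('k) n. kscale (pure n x e) (mact n (\<lambda>i. tvar ^ e i) \<delta> k v))"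
    using assms by (subst hact_pure'[OF dotimes_in_XDer]) (auto simp: dotimes_def mact_scale intro!: sum.cong)
  also have "\<dots> = mact n x \<delta> k v"
    using multilinear_expansion[where \<phi> = "\<lambda>x. mact n x \<delta> k v" and x = x,
      OF multilinear_mact_left[OF assms(2)] module_kscale]
    by (simp add: pure_def)
  finally show ?thesis by (simp add: mact_def)
qed

text \<open>\<open>W(X)\<close> is identified with the derivations of \<open>R(X)\<close> that preserve each \<open>X^(\<otimes> k)\<close>, so it
  is closed under commutators and \<open>p\<close>-th powers.\<close>

context
  notes plus_fun_apply [simp del] zero_fun_apply [simp del] minus_apply [simp del]
begin

definition compat_der :: "(nat \<Rightarrow> 'k::idom_prime_char tens \<Rightarrow> 'k tens) \<Rightarrow> bool"
  where "compat_der D \<longleftrightarrow> (\<forall>k. \<forall>u\<in>Xpow k. \<forall>v\<in>Xpow k.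
    D k u \<in> Xpow k \<and> D k (u + v) = D k u + D k v \<and> (\<forall>c. D k (kscale c u) = kscale c (D k u)) \<and>
    D k (rmult u v) = rmult (D k u) v + rmult u (D k v) \<and> D (Suc k) u = D k u)"

lemma compat_derD:
  fixes D :: "nat \<Rightarrow> 'k::idom_prime_char tens \<Rightarrow> 'k tens"
  assumes "compat_der D" "u \<in> Xpow k"
  shows "D k u \<in> Xpow k" "v \<in> Xpow k \<Longrightarrow> D k (u + v) = D k u + D k v"
    "D k (kscale c u) = kscale c (D k u)"
    "v \<in> Xpow k \<Longrightarrow> D k (rmult u v) = rmult (D k u) v + rmult u (D k v)"
    "D (Suc k) u = D k u"
  using assms unfolding compat_der_def by blast+

lemma Xpow_closed:
  "0 \<in> Xpow n" "u \<in> Xpow n \<Longrightarrow> v \<in> Xpow n \<Longrightarrow> u + v \<in> Xpow n"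
  "u \<in> Xpow n \<Longrightarrow> v \<in> Xpow n \<Longrightarrow> u - v \<in> Xpow n"
  "u \<in> Xpow n \<Longrightarrow> kscale c u \<in> Xpow n" "(\<And>a. a \<in> A \<Longrightarrow> f a \<in> Xpow n) \<Longrightarrow> sum f A \<in> Xpow n"
  using subspace_Xpow[of n]
  by (auto intro: kscale.subspace_0 kscale.subspace_add kscale.subspace_diff kscale.subspace_scale kscale.subspace_sum)

lemma Xpow_induct [consumes 1, case_names zero add scale mono]:
  assumes "v \<in> Xpow n" "P 0" "\<And>u v. u \<in> Xpow n \<Longrightarrow> v \<in> Xpow n \<Longrightarrow> P u \<Longrightarrow> P v \<Longrightarrow> P (u + v)"
    "\<And>c u. u \<in> Xpow n \<Longrightarrow> P u \<Longrightarrow> P (kscale c u)" "\<And>e. P (pure n (\<lambda>i. tvar ^ e i))"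
  shows "P v"
proof -
  have "finite A \<Longrightarrow> P (\<Sum>e\<in>A. kscale (v e) (pure n (\<lambda>i. tvar ^ e i)))" for A
    by (induction A rule: finite_induct) (auto intro!: assms Xpow_closed)
  from this[OF finite_midx] show ?thesis
    using Xpow_expansion[OF assms(1)] by metis
qed

lemma Xpow_Suc: "u \<in> Xpow k \<Longrightarrow> u \<in> Xpow (Suc k)" for u :: "'k::idom_prime_char tens"
  using midx_mono[of k "Suc k" "CHAR('k)"] by (auto simp: Xpow_def)

lemma rmult_in_Xpow: "u \<in> Xpow n \<Longrightarrow> v \<in> Xpow n \<Longrightarrow> rmult u v \<in> Xpow n"
proof (induction u rule: Xpow_induct)
  case (mono e)
  then show ?case
    by (induction v rule: Xpow_induct)
      (auto simp: rmult_0_right rmult_add_right rmult_scale_right rmult_pure Xpow_closed)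
qed (auto simp: rmult_0_left rmult_add_left rmult_scale_left Xpow_closed)

lemma compat_der_0:
  assumes "compat_der D" shows "D k 0 = 0"
  using compat_derD(3)[OF assms, of 0 k 0] by (simp add: Xpow_closed)

lemma compat_der_minus:
  assumes "compat_der D" "u \<in> Xpow k" "v \<in> Xpow k"
  shows "D k (u - v) = D k u - D k v"
  using compat_derD(2)[OF assms(1), of "u - v" k v] assms by (simp add: Xpow_closed algebra_simps)

lemma hact_add: "hact n b k (u + v) = hact n b k u + hact n b k v"
  by (simp add: hact_mact plus_fun_apply kscale.scale_left_distrib sum.distrib)

lemma hact_scale: "hact n b k (kscale c u) = kscale c (hact n b k u)"
  by (simp add: hact_mact kscale.scale_sum_right kscale_apply)

lemma hact_0: "hact n b k 0 = 0"
  by (simp add: hact_mact zero_fun_apply)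

lemma hact_in_Xpow: "hact n b k u \<in> Xpow k"
  unfolding hact_def by (intro Xpow_closed pure_in_Xpow)

lemma mact_mult:
  assumes "\<delta> \<in> Der" "n < k"
  shows "mact n x \<delta> k (\<lambda>i. v i * w i) = rmult (mact n x \<delta> k v) (pure k w) + rmult (pure k v) (mact n x \<delta> k w)"
proof -
  let ?w = "\<lambda>i. if i < n then x i * (v i * w i) else v i * w i"
  interpret h: module_hom tscale kscale "\<lambda>y. pure k (?w(n := y))"
    by (rule module_hom_pure_slot[OF assms(2)])
  have "mact n x \<delta> k (\<lambda>i. v i * w i) = pure k (?w(n := \<delta> (v n) * w n + v n * \<delta> (w n)))"
    unfolding mact_def using assms by (intro pure_cong) (auto simp: Der_def)
  also have "\<dots> = pure k (?w(n := \<delta> (v n) * w n)) + pure k (?w(n := v n * \<delta> (w n)))"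
    by (rule h.add)
  also have "pure k (?w(n := \<delta> (v n) * w n)) = rmult (mact n x \<delta> k v) (pure k w)"
    unfolding mact_def rmult_pure by (rule pure_cong) auto
  also have "pure k (?w(n := v n * \<delta> (w n))) = rmult (pure k v) (mact n x \<delta> k w)"
    unfolding mact_def rmult_pure by (rule pure_cong) (auto simp: algebra_simps)
  finally show ?thesis .
qed

lemma rmult_sum_left: "rmult (\<Sum>a\<in>A. f a) h = (\<Sum>a\<in>A. rmult (f a) h)"
  by (induction A rule: infinite_finite_induct) (auto simp: rmult_0_left rmult_add_left)

lemma rmult_sum_right: "rmult h (\<Sum>a\<in>A. f a) = (\<Sum>a\<in>A. rmult h (f a))"
  by (induction A rule: infinite_finite_induct) (auto simp: rmult_0_right rmult_add_right)

lemma rmult_minus_left: "rmult (f - g) h = rmult f h - rmult g h"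
  using rmult_add_left[of "f - g" g h] by (simp add: algebra_simps)

lemma rmult_minus_right: "rmult h (f - g) = rmult h f - rmult h g"
  using rmult_add_right[of h "f - g" g] by (simp add: algebra_simps)

lemma hact_mult:
  assumes b: "b \<in> XDer n" "n < k" and uv: "u \<in> Xpow k" "v \<in> Xpow k"
  shows "hact n b k (rmult u v) = rmult (hact n b k u) v + rmult u (hact n b k v)"
  using uv(1)
proof (induction u rule: Xpow_induct)
  case (mono e)
  show ?case using uv(2)
  proof (induction v rule: Xpow_induct)
    case (mono f)
    have "b e \<in> Der" for e using b by (auto simp: XDer_def)
    then show ?case
      by (simp add: rmult_pure hact_pure'[OF b(1)] mact_mult b(2) sum.distrib rmult_sum_left rmult_sum_right)
  qed (simp_all add: rmult_0_left rmult_0_right rmult_add_right rmult_scale_right hact_0 hact_add hact_scale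
        kscale.scale_right_distrib algebra_simps)
qed (simp_all add: rmult_0_left rmult_0_right rmult_add_left rmult_scale_left hact_0 hact_add hact_scale
        kscale.scale_right_distrib algebra_simps)

lemma Der_1: "\<delta> \<in> Der \<Longrightarrow> \<delta> 1 = 0"
  unfolding Der_def mem_Collect_eq by (metis add_cancel_left_right mult_1 mult.right_neutral)

lemma mact_eq_0: "i < k \<Longrightarrow> i = n \<Longrightarrow> \<delta> (v i) = 0 \<Longrightarrow> mact n x \<delta> k v = 0"
  unfolding mact_def pure_def by (auto simp: fun_eq_iff zero_fun_apply intro!: prod_zero bexI[of _ n])

lemma hact_one_slot:
  assumes "b \<in> XDer n" "n < k" "v n = 1"
  shows "hact n b k (pure k v) = 0"
  using assms by (subst hact_pure'[OF assms(1)])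
    (auto simp: XDer_def Der_1 intro!: sum.neutral mact_eq_0[of n k n])

lemma hact_Suc:
  assumes b: "b \<in> XDer n" and u: "u \<in> Xpow k" and n: "n \<le> k"
  shows "hact n b (Suc k) u = (if n = k then 0 else hact n b k u)"
  using u
proof (induction u rule: Xpow_induct)
  case (mono e)
  let ?v = "\<lambda>i. tvar ^ e i :: 'a trunc"
  have e: "pure k ?v = pure (Suc k) (?v(k := 1))" by (simp only: pure_embed)
  show ?case
  proof (cases "n = k")
    case True then show ?thesis using b by (simp only: e) (simp add: hact_one_slot)
  next
    case False
    then have "n < k" using n by simp
    have "mact n x \<delta> (Suc k) (?v(k := 1)) = mact n x \<delta> k ?v" for x \<delta>
      unfolding mact_def
      by (subst (2) pure_embed[symmetric]) (rule pure_cong, use \<open>n < k\<close> in auto)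
    then have "hact n b (Suc k) (pure (Suc k) (?v(k := 1))) = hact n b k (pure k ?v)"
      by (simp only: hact_pure'[OF b])
    then show ?thesis using False by (simp only: e[symmetric] if_False)
  qed
qed (simp_all add: hact_0 hact_add hact_scale)

definition dact :: "'k::idom_prime_char wel \<Rightarrow> nat \<Rightarrow> 'k tens \<Rightarrow> 'k tens"
  where "dact a k u = (\<Sum>n<k. hact n (a n) k u)"

lemma act_dact: "act a v = (\<lambda>k. dact a k (v k))"
  by (simp add: act_def dact_def)

lemma compat_der_dact:
  assumes "a \<in> WX" shows "compat_der (dact a)"
  unfolding compat_der_def
proof (intro allI ballI conjI)
  fix k c and u v :: "'a tens" assume uv: "u \<in> Xpow k" "v \<in> Xpow k"
  have a: "a n \<in> XDer n" for n using assms by (auto simp: WX_def)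
  show "dact a k u \<in> Xpow k" by (simp add: dact_def Xpow_closed hact_in_Xpow)
  show "dact a k (u + v) = dact a k u + dact a k v" by (simp add: dact_def hact_add sum.distrib)
  show "dact a k (kscale c u) = kscale c (dact a k u)" by (simp add: dact_def hact_scale kscale.scale_sum_right)
  show "dact a k (rmult u v) = rmult (dact a k u) v + rmult u (dact a k v)"
    by (simp add: dact_def hact_mult[OF a] uv rmult_sum_left rmult_sum_right sum.distrib)
  show "dact a (Suc k) u = dact a k u"
    by (simp add: dact_def hact_Suc[OF a] uv)
qed

lemma compat_der_commutator:
  assumes "compat_der D" "compat_der E"
  shows "compat_der (\<lambda>k u. D k (E k u) - E k (D k u))"
  unfolding compat_der_def
  using assms
  by (auto simp: compat_derD compat_der_minus Xpow_closed rmult_in_Xpow rmult_add_left rmult_add_right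
    rmult_minus_left rmult_minus_right kscale.scale_right_diff_distrib)

lemma compat_der_power_closed:
  assumes "compat_der D" "u \<in> Xpow k"
  shows "(D k ^^ n) u \<in> Xpow k"
  using assms by (induction n) (auto simp: compat_derD)

lemma compat_der_leibniz:
  fixes D :: "nat \<Rightarrow> 'k::idom_prime_char tens \<Rightarrow> 'k tens"
  assumes D: "compat_der D" and uv: "u \<in> Xpow k" "v \<in> Xpow k"
  shows "(D k ^^ n) (rmult u v) =
    (\<Sum>i\<le>n. kscale (of_nat (n choose i)) (rmult ((D k ^^ i) u) ((D k ^^ (n - i)) v)))"
proof (induction n)
  case (Suc n)
  let ?t = "\<lambda>i j. rmult ((D k ^^ i) u) ((D k ^^ j) v)"
  have t: "?t i j \<in> Xpow k" for i j by (simp add: D uv rmult_in_Xpow compat_der_power_closed)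
  have Dt: "D k (?t i j) = ?t (Suc i) j + ?t i (Suc j)" for i j
    by (simp add: compat_derD D uv compat_der_power_closed)
  have Dsum: "finite A \<Longrightarrow> D k (\<Sum>i\<in>A. kscale (c i) (?t i (n - i))) =
    (\<Sum>i\<in>A. kscale (c i) (?t (Suc i) (n - i) + ?t i (Suc (n - i))))" for c and A :: "nat set"
    by (induction A rule: finite_induct)
      (simp_all add: compat_der_0[OF D] compat_derD(2,3)[OF D] Xpow_closed t Dt)
  have "(D k ^^ Suc n) (rmult u v) =
    (\<Sum>i\<le>n. kscale (of_nat (n choose i)) (?t (Suc i) (n - i))) +
    (\<Sum>i\<le>n. kscale (of_nat (n choose i)) (?t i (Suc n - i)))"
    by (simp add: Suc Dsum kscale.scale_right_distrib sum.distrib Suc_diff_le)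
  also have "(\<Sum>i\<le>n. kscale (of_nat (n choose i)) (?t i (Suc n - i))) =
    (\<Sum>i\<le>Suc n. kscale (of_nat (n choose i)) (?t i (Suc n - i)))"
    by (simp add: binomial_eq_0)
  also have "\<dots> = ?t 0 (Suc n) + (\<Sum>i\<le>n. kscale (of_nat (n choose Suc i)) (?t (Suc i) (n - i)))"
    by (subst sum.atMost_Suc_shift) simp
  also have "(\<Sum>i\<le>n. kscale (of_nat (n choose i)) (?t (Suc i) (n - i))) + \<dots> =
    ?t 0 (Suc n) + (\<Sum>i\<le>n. kscale (of_nat (Suc n choose Suc i)) (?t (Suc i) (n - i)))"
    by (simp add: kscale.scale_left_distrib sum.distrib algebra_simps)
  also have "\<dots> = (\<Sum>i\<le>Suc n. kscale (of_nat (Suc n choose i)) (?t i (Suc n - i)))"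
    by (subst sum.atMost_Suc_shift) simp
  finally show ?case .
qed simp

lemma compat_der_power:
  fixes D :: "nat \<Rightarrow> 'k::idom_prime_char tens \<Rightarrow> 'k tens"
  assumes D: "compat_der D"
  shows "compat_der (\<lambda>k u. (D k ^^ CHAR('k)) u)"
  unfolding compat_der_def
proof (intro allI ballI conjI)
  fix k c and u v :: "'k tens" assume uv: "u \<in> Xpow k" "v \<in> Xpow k"
  note cl = compat_der_power_closed[OF D]
  show "(D k ^^ CHAR('k)) u \<in> Xpow k" by (rule cl[OF uv(1)])
  have "(D k ^^ n) (u + v) = (D k ^^ n) u + (D k ^^ n) v" for n
    by (induction n) (simp_all add: compat_derD(2)[OF D] cl uv)
  then show "(D k ^^ CHAR('k)) (u + v) = (D k ^^ CHAR('k)) u + (D k ^^ CHAR('k)) v" .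
  have "(D k ^^ n) (kscale c u) = kscale c ((D k ^^ n) u)" for n
    by (induction n) (simp_all add: compat_derD(3)[OF D] cl uv)
  then show "(D k ^^ CHAR('k)) (kscale c u) = kscale c ((D k ^^ CHAR('k)) u)" .
  have "(D (Suc k) ^^ n) u = (D k ^^ n) u" for n
    by (induction n) (simp_all add: compat_derD(5)[OF D] cl uv)
  then show "(D (Suc k) ^^ CHAR('k)) u = (D k ^^ CHAR('k)) u" .
  have b: "of_nat (CHAR('k) choose i) = (0::'k)" if "0 < i" "i < CHAR('k)" for i
    using dvd_choose_prime[of i "CHAR('k)"] that CHAR_prime[where 'a='k] of_nat_eq_0_iff_char_dvd by auto
  have "(D k ^^ CHAR('k)) (rmult u v) =
    (\<Sum>i\<le>CHAR('k). kscale (of_nat (CHAR('k) choose i)) (rmult ((D k ^^ i) u) ((D k ^^ (CHAR('k) - i)) v)))"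
    by (rule compat_der_leibniz[OF D uv])
  also have "\<dots> = (\<Sum>i\<in>{0, CHAR('k)}. kscale (of_nat (CHAR('k) choose i)) (rmult ((D k ^^ i) u) ((D k ^^ (CHAR('k) - i)) v)))"
    by (rule sum.mono_neutral_right) (auto simp: b)
  also have "\<dots> = rmult ((D k ^^ CHAR('k)) u) v + rmult u ((D k ^^ CHAR('k)) v)"
    using CHAR_pos[where 'a='k] by (simp add: add.commute)
  finally show "(D k ^^ CHAR('k)) (rmult u v) = rmult ((D k ^^ CHAR('k)) u) v + rmult u ((D k ^^ CHAR('k)) v)" .
qed

definition rgen :: "nat \<Rightarrow> 'k::idom_prime_char tens"
  where "rgen m = pure (Suc m) ((\<lambda>_. 1)(m := tvar))"

lemma gen_eq: "m < k \<Longrightarrow> (rgen m :: 'k::idom_prime_char tens) = pure k ((\<lambda>_. 1)(m := tvar))"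
proof (induction k)
  case (Suc k)
  show ?case
  proof (cases "m = k")
    case False
    with Suc have "(rgen m :: 'k tens) = pure k ((\<lambda>_. 1)(m := tvar))" by (simp del: fun_upd_apply)
    also have "\<dots> = pure (Suc k) (((\<lambda>_. 1)(m := tvar))(k := 1))" by (simp only: pure_embed)
    also have "\<dots> = pure (Suc k) ((\<lambda>_. 1)(m := tvar))" by (rule pure_cong) (use False in auto)
    finally show ?thesis .
  qed (simp add: rgen_def del: fun_upd_apply)
qed simp

lemma compat_der_one:
  fixes D :: "nat \<Rightarrow> 'a::idom_prime_char tens \<Rightarrow> 'a tens"
  assumes "compat_der D" shows "D k (pure k (\<lambda>_. 1)) = 0"
proof -
  let ?o = "pure k (\<lambda>_. 1) :: 'a tens"
  have u: "rmult ?o v = v \<and> rmult v ?o = v" if "v \<in> Xpow k" for v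
    using that by (induction v rule: Xpow_induct)
      (auto simp: rmult_0_left rmult_0_right rmult_add_left rmult_add_right rmult_scale_left rmult_scale_right rmult_pure)
  have "D k ?o = D k (rmult ?o ?o)" by (simp add: rmult_pure)
  also have "\<dots> = rmult (D k ?o) ?o + rmult ?o (D k ?o)"
    by (simp only: compat_derD(4)[OF assms] pure_in_Xpow)
  also have "\<dots> = D k ?o + D k ?o"
    by (simp add: compat_derD(1)[OF assms] u)
  finally have "D k ?o + D k ?o = D k ?o + 0" by (simp only: add_0_right)
  then show ?thesis by (rule add_left_imp_eq)
qed

lemma compat_der_ext:
  assumes "compat_der D" "compat_der E" "\<And>m. m < k \<Longrightarrow> D k (rgen m) = E k (rgen m)" "u \<in> Xpow k"
  shows "D k u = E k u"
  using assms(4)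
proof (induction u rule: Xpow_induct)
  case (mono e)
  have "(\<Sum>i<k. e i) = s \<Longrightarrow> D k (pure k (\<lambda>i. tvar ^ e i)) = E k (pure k (\<lambda>i. tvar ^ e i))" for s
  proof (induction s arbitrary: e)
    case 0
    then have "pure k (\<lambda>i. tvar ^ e i) = (pure k (\<lambda>_. 1) :: 'a tens)" by (intro pure_cong) simp
    then show ?case by (simp add: compat_der_one assms)
  next
    case (Suc s)
    then obtain m where m: "m < k" "e m > 0"
      by (metis gr0I lessThan_iff sum.neutral zero_less_Suc less_irrefl)
    let ?e = "e(m := e m - 1)"
    have "(\<Sum>i<k. e i) = Suc (\<Sum>i<k. ?e i)"
      using m by (simp add: sum.remove[of _ m])
    with Suc have IH: "D k (pure k (\<lambda>i. tvar ^ ?e i)) = E k (pure k (\<lambda>i. tvar ^ ?e i))" by simp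
    have g: "rgen m \<in> Xpow k" using m by (simp add: gen_eq)
    have "pure k (\<lambda>i. tvar ^ e i) = rmult (pure k (\<lambda>i. tvar ^ ?e i)) (rgen m)"
      unfolding gen_eq[OF m(1)] rmult_pure using m
      by (intro pure_cong) (auto simp: power_Suc2[symmetric] simp del: power_Suc)
    then show ?case
      using compat_derD(4)[OF assms(1) pure_in_Xpow g] compat_derD(4)[OF assms(2) pure_in_Xpow g]
        IH assms(3)[OF m(1)] by metis
  qed
  then show ?case by blast
qed (simp_all add: compat_der_0 compat_derD assms)

lemma compat_der_gen:
  assumes "compat_der D" "m < k" shows "D k (rgen m) = D (Suc m) (rgen m)"
  using assms(2)
proof (induction k)
  case (Suc k)
  show ?case
  proof (cases "m = k")
    case False
    then have "m < k" using Suc.prems by simp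
    then have "rgen m \<in> Xpow k" by (simp add: gen_eq)
    then show ?thesis using compat_derD(5)[OF assms(1)] Suc.IH[OF \<open>m < k\<close>] by metis
  qed simp
qed simp

lemma compat_der_represented:
  fixes D :: "nat \<Rightarrow> 'k::idom_prime_char tens \<Rightarrow> 'k tens"
  assumes D: "compat_der D"
  shows "\<exists>a\<in>WX. \<forall>k. \<forall>u\<in>Xpow k. dact a k u = D k u"
proof -
  define h where "h n e = (\<Sum>j<CHAR('k). tscale (D (Suc n) (rgen n) (e(n := j))) (tvar ^ j))" for n e
  define a :: "'k wel" where "a n e = (if e \<in> midx CHAR('k) n then (\<lambda>f. h n e * ddx f) else 0)" for n e
  have "(0 :: 'k trunc \<Rightarrow> _) \<in> Der" by (auto simp: Der_def module_hom_iff module_tscale zero_fun_apply)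
  then have XDer: "a n \<in> XDer n" for n
    by (auto simp: a_def XDer_def Der_eq)
  then have WX: "a \<in> WX" by (simp add: WX_def)
  have "dact a k (rgen m) = D k (rgen m)" if m: "m < k" for k m
  proof -
    have "dact a k (rgen m) = dact a (Suc m) (rgen m)"
      by (rule compat_der_gen[OF compat_der_dact[OF WX] m])
    also have "\<dots> = hact m (a m) (Suc m) (rgen m)"
      unfolding dact_def by (simp add: rgen_def hact_one_slot[OF XDer])
    also have "\<dots> = (\<Sum>e\<in>midx CHAR('k) m. pure (Suc m) ((\<lambda>i. tvar ^ e i)(m := h m e)))"
      unfolding rgen_def hact_pure'[OF XDer] mact_def
      by (intro sum.cong refl pure_cong) (auto simp: a_def ddx_tvar)
    also have "\<dots> = (\<Sum>e\<in>midx CHAR('k) m. \<Sum>j<CHAR('k).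
        kscale (D (Suc m) (rgen m) (e(m := j))) (pure (Suc m) (\<lambda>i. tvar ^ (e(m := j)) i)))"
    proof (intro sum.cong refl)
      fix e
      interpret h: module_hom tscale kscale "\<lambda>y. pure (Suc m) ((\<lambda>i. tvar ^ e i :: 'k trunc)(m := y))"
        by (rule module_hom_pure_slot) simp
      have "pure (Suc m) ((\<lambda>i. tvar ^ e i)(m := tvar ^ j)) = (pure (Suc m) (\<lambda>i. tvar ^ (e(m := j)) i) :: 'k tens)" for j
        by (rule pure_cong) auto
      then show "pure (Suc m) ((\<lambda>i. tvar ^ e i)(m := h m e)) = (\<Sum>j<CHAR('k).
        kscale (D (Suc m) (rgen m) (e(m := j))) (pure (Suc m) (\<lambda>i. tvar ^ (e(m := j)) i)))"
        unfolding h_def by (simp only: h.sum h.scale)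
    qed
    also have "\<dots> = (\<Sum>e\<in>midx CHAR('k) (Suc m). kscale (D (Suc m) (rgen m) e) (pure (Suc m) (\<lambda>i. tvar ^ e i)))"
      by (rule sum_midx_Suc[symmetric])
    also have "\<dots> = D (Suc m) (rgen m)"
      by (rule Xpow_expansion[symmetric]) (simp add: compat_derD[OF D] rgen_def)
    also have "\<dots> = D k (rgen m)" by (rule compat_der_gen[OF D m, symmetric])
    finally show ?thesis .
  qed
  note gens = this
  have "dact a k u = D k u" if "u \<in> Xpow k" for k u
    by (rule compat_der_ext[OF compat_der_dact[OF WX] D gens that])
  with WX show ?thesis by blast
qed

lemma act_in_TX: "a \<in> WX \<Longrightarrow> v \<in> TX \<Longrightarrow> act a v \<in> TX"
  using compat_der_dact[of a]
  by (auto simp: TX_def act_dact compat_derD compat_der_0 intro: finite_subset[rotated])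

lemma act_inject:
  fixes a b :: "'k::idom_prime_char wel"
  assumes "a \<in> WX" "b \<in> WX" "\<And>v. v \<in> TX \<Longrightarrow> act a v = act b v"
  shows "a = b"
proof -
  have *: "tcoeff (c n e f) j = act (c :: 'k wel) (\<lambda>k. if k = Suc n then pure k ((\<lambda>_. 1)(n := f)) else 0) (Suc n) (e(n := j))"
    if "c \<in> WX" "e \<in> midx CHAR('k) n" "j < CHAR('k)" for c n e f j
  proof -
    have c: "c n \<in> XDer n" for n using that by (auto simp: WX_def)
    have ej: "e(n := j) \<in> midx CHAR('k) (Suc n)" using that by (auto simp: midx_def)
    have "act c (\<lambda>k. if k = Suc n then pure k ((\<lambda>_. 1)(n := f)) else 0) (Suc n) =
        hact n (c n) (Suc n) (pure (Suc n) ((\<lambda>_. 1)(n := f)))"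
      by (simp add: act_def hact_one_slot[OF c])
    also have "\<dots> = (\<Sum>e\<in>midx CHAR('k) n. pure (Suc n) ((\<lambda>i. tvar ^ e i)(n := c n e f)))"
      unfolding hact_pure'[OF c] mact_def by (intro sum.cong refl pure_cong) auto
    finally have "act c (\<lambda>k. if k = Suc n then pure k ((\<lambda>_. 1)(n := f)) else 0) (Suc n) (e(n := j)) =
      (\<Sum>e\<in>midx CHAR('k) n. pure (Suc n) ((\<lambda>i. tvar ^ e i)(n := c n e f))) (e(n := j))"
      by (simp only:)
    also have "\<dots> = (\<Sum>e'\<in>midx CHAR('k) n. if e' = e then tcoeff (c n e f) j else 0)"
      unfolding sum_fun_apply
    proof (intro sum.cong refl)
      fix e' assume e': "e' \<in> midx CHAR('k) n"
      have "pure (Suc n) ((\<lambda>i. tvar ^ e' i)(n := c n e' f)) (e(n := j)) =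
        (\<Prod>i<n. tcoeff (tvar ^ e' i :: 'k trunc) (e i)) * tcoeff (c n e' f) j"
        using ej by (simp add: pure_def)
      also have "(\<Prod>i<n. tcoeff (tvar ^ e' i :: 'k trunc) (e i)) = pure n (\<lambda>i. tvar ^ e' i) e"
        using that by (simp add: pure_def)
      also have "\<dots> = (if e = e' then 1 else 0)" by (rule pure_mono_apply[OF e'])
      finally show "pure (Suc n) ((\<lambda>i. tvar ^ e' i)(n := c n e' f)) (e(n := j)) =
        (if e' = e then tcoeff (c n e f) j else 0)" by (simp del: fun_upd_apply)
    qed
    also have "\<dots> = tcoeff (c n e f) j" using that by (simp add: sum.delta)
    finally show ?thesis by simp
  qed
  have v: "(\<lambda>k. if k = Suc n then pure k x else 0) \<in> TX" for n and x :: "nat \<Rightarrow> 'k trunc"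
    by (auto simp: TX_def Xpow_closed)
  have "a n e f = b n e f" for n e f
  proof (cases "e \<in> midx CHAR('k) n")
    case True
    then show ?thesis
      by (intro tcoeff_eqI) (simp only: * assms v)
  next
    case False
    then have "a n e = 0" "b n e = 0" using assms(1,2) by (auto simp: WX_def XDer_def)
    then show ?thesis by simp
  qed
  then show ?thesis by blast
qed

lemma compat_der_ex1:
  assumes "compat_der D"
  shows "\<exists>!c. c \<in> WX \<and> (\<forall>v\<in>TX. act c v = (\<lambda>k. D k (v k)))"
proof -
  obtain a where "a \<in> WX" "\<And>k u. u \<in> Xpow k \<Longrightarrow> dact a k u = D k u"
    using compat_der_represented[OF assms] by blast
  then have "a \<in> WX \<and> (\<forall>v\<in>TX. act a v = (\<lambda>k. D k (v k)))"
    by (auto simp: act_dact TX_def)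
  moreover have "c = a" if "c \<in> WX \<and> (\<forall>v\<in>TX. act c v = (\<lambda>k. D k (v k)))" for c
    by (rule act_inject) (use that calculation in auto)
  ultimately show ?thesis by blast
qed

lemma bracket_act:
  assumes "a \<in> WX" "b \<in> WX"
  shows "bracket a b \<in> WX" "v \<in> TX \<Longrightarrow> act (bracket a b) v = act a (act b v) - act b (act a v)"
proof -
  have "act a (act b v) - act b (act a v) = (\<lambda>k. dact a k (dact b k (v k)) - dact b k (dact a k (v k)))" for v
    by (auto simp: act_dact fun_eq_iff minus_apply)
  with compat_der_ex1[OF compat_der_commutator[OF compat_der_dact[OF assms(1)] compat_der_dact[OF assms(2)]]]
  have "\<exists>!c. c \<in> WX \<and> (\<forall>v\<in>TX. act c v = act a (act b v) - act b (act a v))" by simp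
  from theI'[OF this] show "bracket a b \<in> WX" "v \<in> TX \<Longrightarrow> act (bracket a b) v = act a (act b v) - act b (act a v)"
    unfolding bracket_def[symmetric] by auto
qed

lemma ppow_act:
  fixes a :: "'k::idom_prime_char wel"
  assumes "a \<in> WX"
  shows "ppow a \<in> WX" "v \<in> TX \<Longrightarrow> act (ppow a) v = (act a ^^ CHAR('k)) v"
proof -
  have "(act a ^^ n) v = (\<lambda>k. (dact a k ^^ n) (v k))" for v n
    by (induction n) (simp_all add: act_dact)
  with compat_der_ex1[OF compat_der_power[OF compat_der_dact[OF assms]]]
  have "\<exists>!c. c \<in> WX \<and> (\<forall>v\<in>TX. act c v = (act a ^^ CHAR('k)) v)" by simp
  from theI'[OF this] show "ppow a \<in> WX" "v \<in> TX \<Longrightarrow> act (ppow a) v = (act a ^^ CHAR('k)) v"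
    unfolding ppow_def[symmetric] by auto
qed

lemma restricted_subalgebra_WX: "restricted_subalgebra WX"
  unfolding restricted_subalgebra_def
  by (auto simp: bracket_act ppow_act) 
    (auto simp: WX_def XDer_def Der_def module_hom_iff module_tscale wscale_def fun_eq_iff zero_fun_apply plus_fun_apply algebra_simps)

end

end

theory Submission
  imports Defs Complex_Main
begin

text \<open>
  View \<open>a\<close> as the derivation \<open>\<Sum> f\<^sub>n \<partial>\<^sub>n\<close> with \<open>f\<^sub>n = a x\<^sub>n\<close>, and give the monomial \<open>x^e \<partial>\<^sub>n\<close> the weight
  \<open>r^n - \<Sum> e\<^sub>i r^i\<close>. For \<open>r < p\<close> close enough to \<open>p\<close>, all monomials of an \<open>l\<close>-evanescent element have
  weight at least some \<open>\<theta> > 0\<close>. Boundedness says that the degree of the monomials of \<open>f\<^sub>n\<close> is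
  at least \<open>n (p - 1) - m\<close>, with \<open>m\<close> independent of \<open>n\<close>. Both properties pass to the whole restricted algebra
  (with varying \<open>m\<close>), since weights add up and a derivation lowers the degree by at most one.

  Let \<open>d = a^(p^k)\<close>. Its weights are at least \<open>p^k \<theta>\<close>, so \<open>d\<close> kills \<open>x\<^sub>n\<close> as long as
  \<open>r^n < p^k \<theta>\<close>; as \<open>r < p\<close>, for large \<open>k\<close> this covers all \<open>n < k + q\<close>, for any given \<open>q\<close>. On the other
  hand, modulo \<open>x\<^sub>0, \<dots>, x\<^sub>k\<^sub>-\<^sub>1\<close> every monomial of \<open>d x\<^sub>n\<close> has degree at least \<open>(n - k) (p - 1) - m\<close> with the same \<open>m\<close>:
  passing from \<open>d\<close> to \<open>d^p\<close> costs \<open>p - 1\<close> in degree, but this is made up for by setting one more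
  variable to zero. If \<open>q (p - 1) > m\<close>, then \<open>d x\<^sub>n\<close> lies in the ideal generated by \<open>x\<^sub>0, \<dots>, x\<^sub>k\<^sub>+\<^sub>q\<^sub>-\<^sub>1\<close>,
  which is nilpotent and whose generators are killed by \<open>d\<close>. Hence \<open>d\<close> is nilpotent.
\<close>

declare plus_fun_apply [simp del] zero_fun_apply [simp del] minus_apply [simp del]

section \<open>Weight filtrations\<close>

text \<open>The weights \<open>w\<close> may be negative or zero. With weights -1 an upper bound on
  the weight is a lower bound on the degree; with weights -1 on some variables and 0 on the others,
  the levels -s describe the powers of the ideal generated by the former.\<close>

definition wsub :: "(nat \<Rightarrow> real) \<Rightarrow> nat \<Rightarrow> real \<Rightarrow> 'k::idom_prime_char tens set"
  where "wsub w n t = {u \<in> Xpow n. \<forall>e. u e \<noteq> 0 \<longrightarrow> (\<Sum>i<n. w i * real (e i)) \<le> t}"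

lemma XpowD: "u \<in> Xpow n \<Longrightarrow> u e \<noteq> 0 \<Longrightarrow> e \<in> midx CHAR('k) n" for u :: "'k::idom_prime_char tens"
  by (auto simp: Xpow_def)

lemma Xpow_mono: "u \<in> Xpow m \<Longrightarrow> m \<le> n \<Longrightarrow> u \<in> Xpow n" for u :: "'k::idom_prime_char tens"
  using midx_mono[of m n "CHAR('k)"] CHAR_pos[where 'a='k] by (auto simp: Xpow_def)

lemma wsub_Xpow: "u \<in> wsub w n t \<Longrightarrow> u \<in> Xpow n"
  by (simp add: wsub_def)

lemma wsub_0: "0 \<in> wsub w n t"
  by (simp add: wsub_def Xpow_closed zero_fun_apply)

lemma wsub_add: "u \<in> wsub w n t \<Longrightarrow> v \<in> wsub w n t \<Longrightarrow> u + v \<in> wsub w n t"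
  unfolding wsub_def by (auto simp: Xpow_closed plus_fun_apply) (metis add.right_neutral)

lemma wsub_scale: "u \<in> wsub w n t \<Longrightarrow> kscale c u \<in> wsub w n t"
  unfolding wsub_def by (auto simp: Xpow_closed kscale_apply)

lemma wsub_diff: "u \<in> wsub w n t \<Longrightarrow> v \<in> wsub w n t \<Longrightarrow> u - v \<in> wsub w n t"
  unfolding wsub_def by (auto simp: Xpow_closed minus_apply) (metis diff_0_right)

lemma wsub_mono: "u \<in> wsub w n s \<Longrightarrow> s \<le> t \<Longrightarrow> u \<in> wsub w n t"
  unfolding wsub_def by fastforce

lemma wsub_level:
  assumes "u \<in> wsub w m t" "m \<le> n" shows "u \<in> wsub w n t"
proof -
  have "(\<Sum>i<n. w i * real (e i)) = (\<Sum>i<m. w i * real (e i))" if "u e \<noteq> 0" for e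
    using XpowD[OF wsub_Xpow[OF assms(1)], OF that] \<open>m \<le> n\<close>
    by (intro sum.mono_neutral_right) (auto simp: midx_def)
  then show ?thesis using assms by (auto simp: wsub_def intro: Xpow_mono)
qed

lemma wsub_rmult:
  assumes u: "u \<in> wsub w n s" and v: "v \<in> wsub w n t"
  shows "rmult u v \<in> wsub w n (s + t)"
proof -
  have "(\<Sum>i<n. w i * real (e i)) \<le> s + t" if "rmult u v e \<noteq> 0" for e
  proof -
    from that have "(\<Sum>d\<in>{..e}. u d * v (e - d)) \<noteq> 0" by (auto simp: rmult_def split: if_splits)
    then obtain d where "d \<in> {..e}" "u d * v (e - d) \<noteq> 0" by (rule sum.not_neutral_contains_not_neutral)
    then have d: "d \<le> e" "u d \<noteq> 0" "v (e - d) \<noteq> 0" by auto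
    have "w i * real (e i) = w i * real (d i) + w i * real ((e - d) i)" for i
      using le_funD[OF d(1), of i] by (simp add: minus_apply of_nat_diff algebra_simps)
    then have "(\<Sum>i<n. w i * real (e i)) = (\<Sum>i<n. w i * real (d i)) + (\<Sum>i<n. w i * real ((e - d) i))"
      by (simp add: sum.distrib)
    also have "\<dots> \<le> s + t" using d u v by (intro add_mono) (auto simp: wsub_def)
    finally show ?thesis .
  qed
  then show ?thesis using u v by (auto simp: wsub_def rmult_in_Xpow)
qed

lemma rgen_in_Xpow: "rgen n \<in> Xpow (Suc n)"
  by (simp add: rgen_def)

lemma wsub_monomial:
  assumes "e \<in> midx CHAR('k) n"
  shows "(pure n (\<lambda>i. tvar ^ e i) :: 'k::idom_prime_char tens) \<in> wsub w n (\<Sum>i<n. w i * real (e i))"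
  unfolding wsub_def
proof (intro CollectI conjI allI impI pure_in_Xpow)
  fix f assume "(pure n (\<lambda>i. tvar ^ e i) :: 'k tens) f \<noteq> 0"
  then have "f = e" by (rule contrapos_np) (simp add: pure_mono_apply[OF assms])
  then show "(\<Sum>i<n. w i * real (f i)) \<le> (\<Sum>i<n. w i * real (e i))" by simp
qed

text \<open>Induction on the total degree: split off one variable \<open>rgen m\<close> and apply
  the Leibniz rule. In both resulting products exactly one factor has been differentiated, so both
  lose \<theta>, and weights add up under \<open>rmult\<close>.\<close>

lemma compat_der_wsub_monomial:
  fixes D :: "nat \<Rightarrow> 'k::idom_prime_char tens \<Rightarrow> 'k tens"
  assumes D: "compat_der D"
    and gens: "\<And>j. j < n \<Longrightarrow> D (Suc j) (rgen j) \<in> wsub w j (w j - \<theta>)"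
    and e: "e \<in> midx CHAR('k) n"
  shows "D n (pure n (\<lambda>i. tvar ^ e i)) \<in> wsub w n ((\<Sum>i<n. w i * real (e i)) - \<theta>)"
  using e
proof (induction "\<Sum>i<n. e i" arbitrary: e)
  case 0
  then have "pure n (\<lambda>i. tvar ^ e i) = (pure n (\<lambda>_. 1) :: 'k tens)" by (intro pure_cong) simp
  then show ?case by (simp add: compat_der_one[OF D] wsub_0)
next
  case (Suc s)
  then obtain m where m: "m < n" "e m > 0"
    by (metis gr0I lessThan_iff sum.neutral zero_less_Suc less_irrefl)
  let ?e = "e(m := e m - 1)"
  have e': "?e \<in> midx CHAR('k) n" using Suc.prems by (auto simp: midx_def intro: less_imp_diff_less)
  have "s = (\<Sum>i<n. ?e i)" using Suc.hyps(2) m by (simp add: sum.remove[of _ m])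
  note IH = Suc.hyps(1)[OF this e']
  have wt: "(\<Sum>i<n. w i * real (e i)) = (\<Sum>i<n. w i * real (?e i)) + w m"
    using m by (simp add: sum.remove[of _ m] of_nat_diff algebra_simps)
  let ?d = "\<lambda>i. if i = m then 1 else 0 :: nat"
  have rgen: "(rgen m :: 'k tens) = pure n (\<lambda>i. tvar ^ ?d i)"
    unfolding gen_eq[OF m(1)] by (intro pure_cong) auto
  have "?d \<in> midx CHAR('k) n"
    using m CHAR_gt_1[where 'k='k] by (auto simp: midx_def)
  then have "(rgen m :: 'k tens) \<in> wsub w n (\<Sum>i<n. w i * real (?d i))"
    unfolding rgen by (rule wsub_monomial)
  also have "(\<Sum>i<n. w i * real (?d i)) = w m"
    using m by (simp add: if_distrib sum.delta cong: if_cong)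
  finally have g: "(rgen m :: 'k tens) \<in> wsub w n (w m)" .
  have h: "(pure n (\<lambda>i. tvar ^ ?e i) :: 'k tens) \<in> wsub w n (\<Sum>i<n. w i * real (?e i))"
    by (rule wsub_monomial[OF e'])
  have "(pure n (\<lambda>i. tvar ^ e i) :: 'k tens) = rmult (pure n (\<lambda>i. tvar ^ ?e i)) (rgen m)"
    unfolding gen_eq[OF m(1)] rmult_pure using m
    by (intro pure_cong) (auto simp: power_Suc2[symmetric] simp del: power_Suc)
  then have "D n (pure n (\<lambda>i. tvar ^ e i)) =
      rmult (D n (pure n (\<lambda>i. tvar ^ ?e i))) (rgen m) + rmult (pure n (\<lambda>i. tvar ^ ?e i)) (D n (rgen m))"
    by (simp only: compat_derD(4)[OF D pure_in_Xpow wsub_Xpow[OF g]])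
  moreover have "D n (rgen m) \<in> wsub w n (w m - \<theta>)"
    using gens[OF m(1)] m(1) by (simp add: compat_der_gen[OF D m(1)] wsub_level)
  moreover note wsub_rmult[OF IH g] wsub_rmult[OF h this]
  ultimately show ?case unfolding wt
    by (auto intro!: wsub_add simp: algebra_simps simp del: fun_upd_apply)
qed

text \<open>A filtration is respected as soon as this holds on the variables. The sign of \<theta>
  is free: a negative value limits how much \<open>D\<close> can raise the weight.\<close>

lemma compat_der_wsub:
  fixes D :: "nat \<Rightarrow> 'k::idom_prime_char tens \<Rightarrow> 'k tens"
  assumes D: "compat_der D"
    and gens: "\<And>j. j < n \<Longrightarrow> D (Suc j) (rgen j) \<in> wsub w j (w j - \<theta>)"
    and u: "u \<in> wsub w n t"
  shows "D n u \<in> wsub w n (t - \<theta>)"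
proof -
  let ?m = "\<lambda>e. kscale (u e) (pure n (\<lambda>i. tvar ^ e i))"
  have *: "A \<subseteq> midx CHAR('k) n \<Longrightarrow> D n (\<Sum>e\<in>A. ?m e) \<in> wsub w n (t - \<theta>)" if "finite A" for A
    using that
  proof (induction A rule: finite_induct)
    case (insert e A)
    have "D n (\<Sum>e\<in>insert e A. ?m e) = kscale (u e) (D n (pure n (\<lambda>i. tvar ^ e i))) + D n (\<Sum>e\<in>A. ?m e)"
      using insert.hyps by (simp add: compat_derD(2,3)[OF D] Xpow_closed)
    moreover have "kscale (u e) (D n (pure n (\<lambda>i. tvar ^ e i))) \<in> wsub w n (t - \<theta>)"
    proof (cases "u e = 0")
      case False
      then have "(\<Sum>i<n. w i * real (e i)) \<le> t" using u by (auto simp: wsub_def)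
      moreover have "e \<in> midx CHAR('k) n" using insert.prems by auto
      ultimately show ?thesis
        by (intro wsub_scale wsub_mono[OF compat_der_wsub_monomial[OF D gens]]) auto
    qed (simp add: kscale_def wsub_0 flip: zero_fun_def)
    ultimately show ?case using insert by (auto intro: wsub_add)
  qed (simp add: compat_der_0[OF D] wsub_0)
  have "D n u = D n (\<Sum>e\<in>midx CHAR('k) n. ?m e)"
    by (rule arg_cong[OF Xpow_expansion[OF wsub_Xpow[OF u]]])
  then show ?thesis using *[OF finite_midx subset_refl] by (simp only:)
qed

lemma compat_der_funpow_wsub:
  fixes D :: "nat \<Rightarrow> 'k::idom_prime_char tens \<Rightarrow> 'k tens"
  assumes D: "compat_der D"
    and gens: "\<And>j. j < n \<Longrightarrow> D (Suc j) (rgen j) \<in> wsub w j (w j - \<theta>)"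
    and u: "u \<in> wsub w n t"
  shows "(D n ^^ s) u \<in> wsub w n (t - real s * \<theta>)"
proof (induction s)
  case (Suc s)
  then show ?case using compat_der_wsub[OF D gens Suc] by (simp add: algebra_simps)
qed (use u in simp)

section \<open>Elements of \<open>WX\<close> as derivations, and their values on the
  variables\<close>

lemma dact_rgen_apply:
  fixes a :: "'k::idom_prime_char wel"
  assumes "a \<in> WX"
  shows "dact a (Suc n) (rgen n) e =
    (if e \<in> midx CHAR('k) (Suc n) then tcoeff (a n (e(n := 0)) tvar) (e n) else 0)"
proof -
  have XDer: "a n \<in> XDer n" for n using assms by (simp add: WX_def)
  \<comment> \<open>The components \<open>a j\<close> with j < n differentiate a factor 1 of
    \<open>rgen n\<close>, hence contribute 0.\<close>
  have "dact a (Suc n) (rgen n) = hact n (a n) (Suc n) (rgen n)"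
    unfolding dact_def by (simp add: rgen_def hact_one_slot[OF XDer])
  also have "\<dots> = (\<Sum>f\<in>midx CHAR('k) n. pure (Suc n) ((\<lambda>i. tvar ^ f i)(n := a n f tvar)))"
    unfolding rgen_def hact_pure'[OF XDer] mact_def by (intro sum.cong refl pure_cong) auto
  finally have "dact a (Suc n) (rgen n) e =
      (\<Sum>f\<in>midx CHAR('k) n. pure (Suc n) ((\<lambda>i. tvar ^ f i)(n := a n f tvar)) e)"
    by (simp add: sum_fun_apply del: fun_upd_apply)
  also have "\<dots> = (if e \<in> midx CHAR('k) (Suc n) then tcoeff (a n (e(n := 0)) tvar) (e n) else 0)"
  proof (cases "e \<in> midx CHAR('k) (Suc n)")
    case True
    then have e0: "e(n := 0) \<in> midx CHAR('k) n" by (auto simp: midx_def)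
    have "pure (Suc n) ((\<lambda>i. tvar ^ f i)(n := a n f tvar)) e =
      (if f = e(n := 0) then tcoeff (a n (e(n := 0)) tvar) (e n) else 0)" if f: "f \<in> midx CHAR('k) n" for f
    proof -
      have "pure (Suc n) ((\<lambda>i. tvar ^ f i)(n := a n f tvar)) e =
        (\<Prod>i<n. tcoeff (tvar ^ f i :: 'k trunc) (e i)) * tcoeff (a n f tvar) (e n)"
        using True by (simp add: pure_def)
      also have "(\<Prod>i<n. tcoeff (tvar ^ f i :: 'k trunc) (e i)) = pure n (\<lambda>i. tvar ^ f i) (e(n := 0))"
        using e0 by (simp add: pure_def)
      also have "\<dots> = (if e(n := 0) = f then 1 else 0)" by (rule pure_mono_apply[OF f])
      finally show ?thesis by (auto simp del: fun_upd_apply)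
    qed
    then show ?thesis using True e0 by (simp add: sum.delta del: fun_upd_apply)
  qed (simp add: pure_def)
  finally show ?thesis .
qed

text \<open>The bracket is specified through its action on \<open>TX\<close>; a single tensor
  \<open>u\<close> is tested by placing it in degree \<open>k\<close> of an otherwise zero
  sequence.\<close>

lemma dact_bracket:
  assumes "a \<in> WX" "b \<in> WX" "u \<in> Xpow k"
  shows "dact (bracket a b) k u = dact a k (dact b k u) - dact b k (dact a k u)"
proof -
  let ?v = "\<lambda>i. if i = k then u else 0"
  have "?v \<in> TX" using assms(3) by (auto simp: TX_def Xpow_closed)
  from bracket_act(2)[OF assms(1,2) this] have "act (bracket a b) ?v k = (act a (act b ?v) - act b (act a ?v)) k"
    by (simp only:)
  then show ?thesis by (simp add: act_dact minus_apply)
qed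

lemma dact_ppow:
  fixes a :: "'k::idom_prime_char wel"
  assumes "a \<in> WX" "u \<in> Xpow k"
  shows "dact (ppow a) k u = (dact a k ^^ CHAR('k)) u"
proof -
  let ?v = "\<lambda>i. if i = k then u else 0"
  have v: "?v \<in> TX" using assms(2) by (auto simp: TX_def Xpow_closed)
  have "(act a ^^ n) ?v k = (dact a k ^^ n) u" for n
    by (induction n) (simp_all add: act_dact)
  moreover have "act (ppow a) ?v k = (act a ^^ CHAR('k)) ?v k"
    by (simp only: ppow_act(2)[OF assms(1) v])
  ultimately show ?thesis by (simp add: act_dact)
qed

lemma ppow_funpow_WX: "a \<in> WX \<Longrightarrow> (ppow ^^ j) a \<in> WX"
  by (induction j) (simp_all add: ppow_act)

lemma dact_ppow_funpow:
  fixes a :: "'k::idom_prime_char wel"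
  assumes "a \<in> WX" "u \<in> Xpow k"
  shows "dact ((ppow ^^ j) a) k u = (dact a k ^^ (CHAR('k) ^ j)) u"
  using assms(2)
proof (induction j arbitrary: u)
  case (Suc j)
  note IH = Suc.IH and u = Suc.prems
  let ?b = "(ppow ^^ j) a"
  have b: "?b \<in> WX" by (rule ppow_funpow_WX[OF assms(1)])
  have "(dact ?b k ^^ s) u = (dact a k ^^ (CHAR('k) ^ j * s)) u" for s
  proof (induction s)
    case (Suc s)
    have "(dact a k ^^ (CHAR('k) ^ j * s)) u \<in> Xpow k"
      by (rule compat_der_power_closed[OF compat_der_dact[OF assms(1)] u])
    then show ?case
      using IH Suc by (simp add: funpow_add)
  qed simp
  then show ?case using dact_ppow[OF b u] by (simp add: mult.commute)
qed simp

lemma dact_zero: "dact 0 k u = 0" for u :: "'k::idom_prime_char tens"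
proof -
  have "mact n x 0 k v = 0" if "n < k" for n and x v :: "nat \<Rightarrow> 'k trunc"
    using that by (intro mact_eq_0[of n]) (simp_all add: zero_fun_apply)
  then show ?thesis by (simp add: dact_def hact_mact zero_fun_apply)
qed

lemma dact_inject_0:
  fixes a :: "'k::idom_prime_char wel"
  assumes "a \<in> WX" "\<And>k u. u \<in> Xpow k \<Longrightarrow> dact a k u = 0"
  shows "a = 0"
proof (rule act_inject)
  show "0 \<in> (WX :: 'k wel set)" using restricted_subalgebra_WX[where 'a='k] by (simp add: restricted_subalgebra_def)
  fix v :: "nat \<Rightarrow> 'k tens" assume "v \<in> TX"
  then have "v k \<in> Xpow k" for k by (simp add: TX_def)
  then show "act a v = act 0 v" by (simp add: act_dact dact_zero assms(2))
qed (fact assms)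

lemma compat_der_funpow_Suc:
  assumes "compat_der D" "u \<in> Xpow k"
  shows "(D (Suc k) ^^ s) u = (D k ^^ s) u"
  by (induction s) (simp_all add: compat_derD(5)[OF assms(1)] compat_der_power_closed[OF assms])

text \<open>The first application replaces the variable by its coefficient, which lies in
  \<open>Xpow n\<close>; only p - 1 applications remain, and they take place among the earlier
  variables. This p - 1 is the cost in degree counted below.\<close>

lemma dact_ppow_rgen:
  fixes a :: "'k::idom_prime_char wel"
  assumes "a \<in> WX" "dact a (Suc n) (rgen n) \<in> Xpow n"
  shows "dact (ppow a) (Suc n) (rgen n) = (dact a n ^^ (CHAR('k) - 1)) (dact a (Suc n) (rgen n))"
proof -
  have "CHAR('k) = Suc (CHAR('k) - 1)" using CHAR_pos[where 'a='k] by simp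
  then have "dact (ppow a) (Suc n) (rgen n) = (dact a (Suc n) ^^ Suc (CHAR('k) - 1)) (rgen n)"
    using dact_ppow[OF assms(1) rgen_in_Xpow] by metis
  also have "\<dots> = (dact a (Suc n) ^^ (CHAR('k) - 1)) (dact a (Suc n) (rgen n))"
    by (simp only: funpow_Suc_right o_apply)
  finally show ?thesis
    by (simp only: compat_der_funpow_Suc[OF compat_der_dact[OF assms(1)] assms(2)])
qed

lemma wsub_nonpos: "u \<in> Xpow n \<Longrightarrow> (\<And>i. i < n \<Longrightarrow> w i \<le> 0) \<Longrightarrow> u \<in> wsub w n 0"
  unfolding wsub_def by (auto intro!: sum_nonpos mult_nonpos_nonneg)

lemma wsub_eq_0:
  fixes u :: "'k::idom_prime_char tens"
  assumes "u \<in> wsub w n t" "\<And>e. e \<in> midx CHAR('k) n \<Longrightarrow> t < (\<Sum>i<n. w i * real (e i))"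
  shows "u = 0"
proof
  fix e
  show "u e = 0 e"
    using assms(1) assms(2)[of e] XpowD[OF wsub_Xpow[OF assms(1)], of e]
    by (force simp: wsub_def zero_fun_apply)
qed

lemma weight_le_single:
  fixes w :: "nat \<Rightarrow> real" and e :: "nat \<Rightarrow> nat"
  assumes "\<And>i. i < n \<Longrightarrow> w i \<le> 0" "j < n" "e j \<noteq> 0"
  shows "(\<Sum>i<n. w i * real (e i)) \<le> w j"
proof -
  have "(\<Sum>i<n. w i * real (e i)) = w j * real (e j) + (\<Sum>i\<in>{..<n}-{j}. w i * real (e i))"
    using assms(2) by (simp add: sum.remove)
  also have "\<dots> \<le> w j * 1 + 0"
    using assms by (intro add_mono mult_left_mono_neg sum_nonpos mult_nonpos_nonneg) auto
  finally show ?thesis by simp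
qed

section \<open>The restricted algebra of tame elements\<close>

text \<open>The second condition, with weights \<open>-1\<close>, bounds degrees from below: it is boundedness of \<open>a\<close>,
  for coefficients that do not involve \<open>x\<^sub>n\<close> itself.\<close>

definition tame :: "real \<Rightarrow> real \<Rightarrow> real \<Rightarrow> 'k::idom_prime_char wel \<Rightarrow> bool"
  where "tame r \<theta> m a \<longleftrightarrow> (\<forall>n. dact a (Suc n) (rgen n) \<in> wsub ((^) r) n (r ^ n - \<theta>) \<and>
    dact a (Suc n) (rgen n) \<in> wsub (\<lambda>_. -1) n (m - real n * (real CHAR('k) - 1)))"

lemma tame_mono: "tame r \<theta> m a \<Longrightarrow> m \<le> m' \<Longrightarrow> tame r \<theta> m' a"
  unfolding tame_def by (fastforce intro: wsub_mono)

lemma tame_Xpow: "tame r \<theta> m a \<Longrightarrow> dact a (Suc n) (rgen n) \<in> Xpow n"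
  unfolding tame_def by (blast intro: wsub_Xpow)

lemma tame_funpow_wsub:
  fixes a :: "'k::idom_prime_char wel"
  assumes "a \<in> WX" "tame r \<theta> m a" "0 \<le> \<theta>"
  shows "u \<in> wsub ((^) r) n t \<Longrightarrow> (dact a n ^^ s) u \<in> wsub ((^) r) n (t - real s * \<theta>)"
    and "u \<in> wsub (\<lambda>_. -1) n t \<Longrightarrow> (dact a n ^^ s) u \<in> wsub (\<lambda>_. -1) n (t + real s)"
proof -
  note D = compat_der_dact[OF assms(1)]
  show "u \<in> wsub ((^) r) n t \<Longrightarrow> (dact a n ^^ s) u \<in> wsub ((^) r) n (t - real s * \<theta>)"
    using assms(2) by (intro compat_der_funpow_wsub[OF D]) (simp_all add: tame_def)
  assume u: "u \<in> wsub (\<lambda>_. -1) n t"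
  \<comment> \<open>Here \<theta> is -1: the required level for the value on a variable is -1 - (-1)
    = 0, which every tensor has. This says that a derivation lowers the degree by at most
    one.\<close>
  have "(dact a n ^^ s) u \<in> wsub (\<lambda>_. -1) n (t - real s * (-1))"
    using wsub_nonpos[OF tame_Xpow[OF assms(2)], of _ "\<lambda>_. -1"] u
    by (intro compat_der_funpow_wsub[OF D]) simp_all
  then show "(dact a n ^^ s) u \<in> wsub (\<lambda>_. -1) n (t + real s)" by simp
qed

text \<open>Each product of two derivations gains \<theta> twice, of which one is given away to stay
  within the same class, and the second derivation costs one degree.\<close>

lemma tame_bracket:
  fixes a b :: "'k::idom_prime_char wel"
  assumes "a \<in> WX" "b \<in> WX" "tame r \<theta> m a" "tame r \<theta> m b" "0 \<le> \<theta>"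
  shows "tame r \<theta> (m + 1) (bracket a b)"
proof -
  have *: "dact a (Suc n) (dact b (Suc n) (rgen n)) \<in> wsub ((^) r) n (r ^ n - \<theta>)"
    "dact a (Suc n) (dact b (Suc n) (rgen n)) \<in> wsub (\<lambda>_. -1) n (m + 1 - real n * (real CHAR('k) - 1))"
    if "a \<in> WX" "tame r \<theta> m a" "tame r \<theta> m b" for a b :: "'k wel" and n
  proof -
    let ?g = "dact b (Suc n) (rgen n)"
    have eq: "dact a (Suc n) ?g = dact a n ?g"
      by (rule compat_derD(5)[OF compat_der_dact[OF that(1)] tame_Xpow[OF that(3)]])
    show "dact a (Suc n) ?g \<in> wsub ((^) r) n (r ^ n - \<theta>)"
      using tame_funpow_wsub(1)[OF that(1,2) assms(5), of ?g n "r ^ n - \<theta>" 1] that(3) assms(5)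
      by (auto simp: eq tame_def elim: wsub_mono)
    show "dact a (Suc n) ?g \<in> wsub (\<lambda>_. -1) n (m + 1 - real n * (real CHAR('k) - 1))"
      using tame_funpow_wsub(2)[OF that(1,2) assms(5), of ?g n "m - real n * (real CHAR('k) - 1)" 1] that(3)
      by (auto simp: eq tame_def algebra_simps)
  qed
  show ?thesis
    unfolding tame_def dact_bracket[OF assms(1,2) rgen_in_Xpow]
    using assms * by (auto intro!: wsub_diff)
qed

text \<open>The weight gain is multiplied by p, but the degree constant grows by p - 1. Under
  iteration this growth is too large to be used directly; \<open>sectional\<close> below avoids
  it.\<close>

lemma tame_ppow:
  fixes a :: "'k::idom_prime_char wel"
  assumes "a \<in> WX" "tame r \<theta> m a" "0 \<le> \<theta>"
  shows "tame r (real CHAR('k) * \<theta>) (m + real CHAR('k) - 1) (ppow a)"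
  unfolding tame_def
proof (intro allI conjI)
  fix n
  let ?g = "dact a (Suc n) (rgen n)"
  have p: "real (CHAR('k) - 1) = real CHAR('k) - 1" using CHAR_pos[where 'a='k] by (simp add: of_nat_diff Suc_le_eq)
  note eq = dact_ppow_rgen[OF assms(1) tame_Xpow[OF assms(2)], of n]
  show "dact (ppow a) (Suc n) (rgen n) \<in> wsub ((^) r) n (r ^ n - real CHAR('k) * \<theta>)"
    using tame_funpow_wsub(1)[OF assms, of ?g n "r ^ n - \<theta>" "CHAR('k) - 1"] assms(2)
    by (simp add: eq tame_def p algebra_simps del: One_nat_def)
  show "dact (ppow a) (Suc n) (rgen n) \<in>
      wsub (\<lambda>_. -1) n (m + real CHAR('k) - 1 - real n * (real CHAR('k) - 1))"
    using tame_funpow_wsub(2)[OF assms, of ?g n "m - real n * (real CHAR('k) - 1)" "CHAR('k) - 1"] assms(2)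
    by (simp add: eq tame_def p algebra_simps del: One_nat_def)
qed

lemma tame_theta_mono: "tame r \<theta> m a \<Longrightarrow> \<theta>' \<le> \<theta> \<Longrightarrow> tame r \<theta>' m a"
  unfolding tame_def by (fastforce intro: wsub_mono)

text \<open>Quantifying over \<open>m\<close> element by element absorbs the growth of the degree
  constant, whereas \<theta> is common to the whole algebra.\<close>

lemma restricted_subalgebra_tame:
  assumes "0 \<le> \<theta>"
  shows "restricted_subalgebra {a :: 'k::idom_prime_char wel. a \<in> WX \<and> (\<exists>m. tame r \<theta> m a)}"
  unfolding restricted_subalgebra_def
proof (intro conjI ballI allI)
  note WX = restricted_subalgebra_WX[where 'a='k, unfolded restricted_subalgebra_def]
  let ?L = "{a :: 'k wel. a \<in> WX \<and> (\<exists>m. tame r \<theta> m a)}"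
  show "?L \<subseteq> WX" by blast
  show "0 \<in> ?L" using WX by (auto simp: tame_def dact_zero wsub_0)
  fix a assume "a \<in> ?L"
  then obtain m where a: "a \<in> WX" "tame r \<theta> m a" by blast
  show "wscale c a \<in> ?L" for c
  proof -
    have *: "wscale c a \<in> WX" using a WX by blast
    then have "dact (wscale c a) (Suc n) (rgen n) = kscale c (dact a (Suc n) (rgen n))" for n
      using a by (auto simp: dact_rgen_apply kscale_apply wscale_def fun_eq_iff)
    then show ?thesis using a * by (auto simp: tame_def intro!: exI[of _ m] wsub_scale)
  qed
  have "\<theta> \<le> real CHAR('k) * \<theta>"
    using mult_right_mono[of 1 "real CHAR('k)" \<theta>] CHAR_gt_1[where 'k='k] assms by simp
  from tame_theta_mono[OF tame_ppow[OF a assms] this]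
  show "ppow a \<in> ?L" using a ppow_act(1) by blast
  fix b assume "b \<in> ?L"
  then obtain m' where b: "b \<in> WX" "tame r \<theta> m' b" by blast
  have t: "tame r \<theta> (max m m') a" "tame r \<theta> (max m m') b"
    using a b by (auto elim: tame_mono)
  show "bracket a b \<in> ?L"
    using tame_bracket[OF a(1) b(1) t assms] bracket_act(1)[OF a(1) b(1)] by blast
  show "a + b \<in> ?L"
  proof -
    have *: "a + b \<in> WX" using a b WX by blast
    then have "dact (a + b) (Suc n) (rgen n) = dact a (Suc n) (rgen n) + dact b (Suc n) (rgen n)" for n
      using a b by (auto simp: dact_rgen_apply plus_fun_apply fun_eq_iff)
    then show ?thesis using t * by (auto simp: tame_def intro!: exI[of _ "max m m'"] wsub_add)
  qed
qed

section \<open>Nilpotency of tame elements\<close>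

text \<open>The last condition concerns the coefficients of \<open>a\<close> modulo the variables \<open>x\<^sub>i\<close> with \<open>i < k\<close>.\<close>

definition sectional :: "nat \<Rightarrow> real \<Rightarrow> 'k::idom_prime_char wel \<Rightarrow> bool"
  where "sectional k m a \<longleftrightarrow> (\<forall>n. dact a (Suc n) (rgen n) \<in> Xpow n \<and>
    (n < k \<longrightarrow> dact a (Suc n) (rgen n) = 0) \<and>
    (\<forall>e. dact a (Suc n) (rgen n) e \<noteq> 0 \<longrightarrow> (\<forall>i<k. e i = 0) \<longrightarrow>
      (real n - real k) * (real CHAR('k) - 1) \<le> (\<Sum>i<n. real (e i)) + m))"

text \<open>The variables of index below \<open>k\<close> are killed by \<open>a\<close>, so one can
  compute modulo them. The value of \<open>a\<close> on the variable of index \<open>k\<close>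
  involves only killed variables, so a second application gives 0. For the other variables the p - 1
  further applications lose p - 1 in degree, exactly the change of the bound from \<open>k\<close>
  to \<open>Suc k\<close>.\<close>

lemma sectional_ppow:
  fixes a :: "'k::idom_prime_char wel"
  assumes a: "a \<in> WX" and sec: "sectional k m a"
  shows "sectional (Suc k) m (ppow a)"
  unfolding sectional_def
proof (intro allI conjI impI)
  fix n
  let ?p = "CHAR('k)" and ?g = "dact a (Suc n) (rgen n)"
  note D = compat_der_dact[OF a]
  have p: "real (?p - 1) = real ?p - 1" "?p > 1"
    using CHAR_gt_1[where 'k='k] by (simp_all add: of_nat_diff Suc_le_eq)
  have X: "dact a (Suc j) (rgen j) \<in> Xpow j" for j
    using sec by (simp add: sectional_def)
  have z: "dact a (Suc j) (rgen j) = 0" if "j < k" for j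
    using sec that by (simp add: sectional_def)
  have eq: "dact (ppow a) (Suc n) (rgen n) = (dact a n ^^ (?p - 1)) ?g"
    by (rule dact_ppow_rgen[OF a X])
  show "dact (ppow a) (Suc n) (rgen n) \<in> Xpow n"
    unfolding eq by (rule compat_der_power_closed[OF D X])
  {
    assume "n < Suc k"
    \<comment> \<open>All weights are 0 and \<theta> = 1, which is legitimate because the variables
      of index below \<open>n\<close> are killed. The resulting level is negative as p > 1, so only
      0 remains.\<close>
    then have "(dact a n ^^ (?p - 1)) ?g \<in> wsub (\<lambda>_. 0) n (0 - real (?p - 1) * 1)"
      by (intro compat_der_funpow_wsub[OF D] wsub_nonpos X) (simp_all add: z wsub_0)
    then show "dact (ppow a) (Suc n) (rgen n) = 0"
      unfolding eq by (rule wsub_eq_0) (use p in simp)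
  }
  fix e assume e: "dact (ppow a) (Suc n) (rgen n) e \<noteq> 0" "\<forall>i<Suc k. e i = 0"
  \<comment> \<open>The first \<open>k\<close> variables get so large a weight that all monomials involving them satisfy the
    bound trivially: this is how to compute modulo these variables.\<close>
  define t where "t = m - (real n - real k) * (real ?p - 1)"
  define w where "w i = (if i < k then - \<bar>t\<bar> else - 1)" for i
  have w: "w i \<le> 0" for i by (simp add: w_def)
  \<comment> \<open>For j \<ge> k the level is 0, for j < k the value is 0. Hence the loss per
    application is one, in spite of the large weights.\<close>
  have "dact a (Suc j) (rgen j) \<in> wsub w j (w j - (- 1))" for j
  proof (cases "j < k")
    case False
    then show ?thesis using wsub_nonpos[of _ j w, OF X w] by (simp add: w_def)
  qed (simp add: z wsub_0)
  moreover have "?g \<in> wsub w n t"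
    unfolding wsub_def
  proof (intro CollectI conjI allI impI X)
    fix f assume f: "?g f \<noteq> 0"
    show "(\<Sum>i<n. w i * real (f i)) \<le> t"
    proof (cases "\<forall>i<k. f i = 0")
      case True
      then have "w i * real (f i) = - real (f i)" for i by (simp add: w_def)
      moreover have "(real n - real k) * (real ?p - 1) \<le> (\<Sum>i<n. real (f i)) + m"
        using True f sec by (simp add: sectional_def)
      ultimately show ?thesis by (simp add: t_def sum_negf)
    next
      case False
      then obtain i where i: "i < k" "f i \<noteq> 0" by blast
      moreover have "i < n" using XpowD[OF X, OF f] i by (cases "i < n") (auto simp: midx_def)
      ultimately have "(\<Sum>i<n. w i * real (f i)) \<le> w i" by (intro weight_le_single w)
      then show ?thesis using i by (simp add: w_def)
    qed
  qed
  ultimately have "(dact a n ^^ (?p - 1)) ?g \<in> wsub w n (t - real (?p - 1) * (- 1))"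
    by (intro compat_der_funpow_wsub[OF D])
  then have "(\<Sum>i<n. w i * real (e i)) \<le> t + (real ?p - 1)"
    using e(1) unfolding eq wsub_def p(1) by auto
  moreover have "w i * real (e i) = - real (e i)" for i using e(2) by (simp add: w_def)
  ultimately show "(real n - real (Suc k)) * (real ?p - 1) \<le> (\<Sum>i<n. real (e i)) + m"
    by (simp add: t_def sum_negf algebra_simps)
qed

lemma tame_imp_sectional:
  fixes a :: "'k::idom_prime_char wel"
  assumes "tame r \<theta> m a" shows "sectional 0 m a"
proof -
  have "real n * (real CHAR('k) - 1) \<le> (\<Sum>i<n. real (e i)) + m"
    if "dact a (Suc n) (rgen n) e \<noteq> 0" for n e
  proof -
    have "(\<Sum>i<n. - 1 * real (e i)) \<le> m - real n * (real CHAR('k) - 1)"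
      using assms that unfolding tame_def wsub_def by blast
    then show ?thesis by (simp add: sum_negf)
  qed
  then show ?thesis using tame_Xpow[OF assms] by (simp add: sectional_def)
qed

text \<open>Let I be the ideal generated by the first \<open>K\<close> variables. As
  \<open>a\<close> kills these and maps every other variable into I, it maps each power of I into
  the next one, and a high enough power of I vanishes.\<close>

lemma nil_of_ideal:
  fixes a :: "'k::idom_prime_char wel"
  assumes a: "a \<in> WX" and X: "\<And>n. dact a (Suc n) (rgen n) \<in> Xpow n"
    and z: "\<And>n. n < K \<Longrightarrow> dact a (Suc n) (rgen n) = 0"
    and ideal: "\<And>n e. K \<le> n \<Longrightarrow> dact a (Suc n) (rgen n) e \<noteq> 0 \<Longrightarrow> \<exists>i<K. e i \<noteq> 0"
  shows "\<exists>j. (ppow ^^ j) a = 0"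
proof -
  let ?p = "CHAR('k)" and ?w = "\<lambda>i. if i < K then - 1 else 0 :: real"
  have gens: "dact a (Suc j) (rgen j) \<in> wsub ?w j (?w j - 1)" for j
  proof (cases "j < K")
    case False
    show ?thesis unfolding wsub_def
    proof (intro CollectI conjI allI impI X)
      fix e assume e: "dact a (Suc j) (rgen j) e \<noteq> 0"
      then obtain i where i: "i < K" "e i \<noteq> 0" using ideal[of j e] False by auto
      have "(\<Sum>i<j. ?w i * real (e i)) \<le> ?w i"
        by (rule weight_le_single) (use i False in auto)
      then show "(\<Sum>i<j. ?w i * real (e i)) \<le> ?w j - 1" using i False by simp
    qed
  qed (simp add: z wsub_0)
  \<comment> \<open>The exponent \<open>K * ?p\<close> makes \<open>s\<close> a power of p exceeding
    K (p - 1), the largest degree in the first \<open>K\<close> variables.\<close>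
  define s where "s = ?p ^ (K * ?p)"
  have s: "K * ?p < s" unfolding s_def using CHAR_gt_1[where 'k='k] by (intro power_gt_expt) simp
  have "dact ((ppow ^^ (K * ?p)) a) n u = 0" if u: "u \<in> Xpow n" for n u
  proof -
    have "(dact a n ^^ s) u \<in> wsub ?w n (0 - real s * 1)"
      by (intro compat_der_funpow_wsub[OF compat_der_dact[OF a]] gens wsub_nonpos u) auto
    then have "(dact a n ^^ s) u = 0"
    proof (rule wsub_eq_0)
      fix e assume e: "e \<in> midx ?p n"
      have "- real s < - real (K * ?p)" using s by (simp only: neg_less_iff_less of_nat_less_iff)
      also have "\<dots> = (\<Sum>i<K. - real ?p)" by simp
      also have "\<dots> \<le> (\<Sum>i<K. if i < n then - real (e i) else 0)"
        by (intro sum_mono) (use e in \<open>auto simp: midx_def intro: less_imp_le\<close>)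
      also have "\<dots> = (\<Sum>i\<in>{..<K} \<inter> {..<n}. - real (e i))"
        by (simp add: sum.inter_restrict)
      also have "\<dots> = (\<Sum>i\<in>{..<n} \<inter> {..<K}. - real (e i))" by (simp add: Int_commute)
      also have "\<dots> = (\<Sum>i<n. ?w i * real (e i))"
        by (subst sum.inter_restrict) (auto intro!: sum.cong)
      finally show "0 - real s * 1 < (\<Sum>i<n. ?w i * real (e i))" by simp
    qed
    then show ?thesis by (simp add: dact_ppow_funpow[OF a u] s_def)
  qed
  then show ?thesis using dact_inject_0[OF ppow_funpow_WX[OF a]] by blast
qed

lemma tame_nil:
  fixes a :: "'k::idom_prime_char wel"
  assumes a: "a \<in> WX" "tame r \<theta> m a" and r: "1 < r" "r < real CHAR('k)" and \<theta>: "0 < \<theta>"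
  shows "\<exists>j. (ppow ^^ j) a = 0"
proof -
  let ?p = "CHAR('k)" and ?A = "\<lambda>k. (ppow ^^ k) a"
  have p: "real ?p > 1" using CHAR_gt_1[where 'k='k] by simp
  \<comment> \<open>The constant \<open>m\<close> of \<open>sectional\<close> is the same for all
    \<open>k\<close>, so that \<open>q\<close> can be chosen before \<open>k\<close>; the
    \<open>m'\<close> of \<open>tame\<close> may grow with \<open>k\<close>.\<close>
  have A: "?A k \<in> WX" "sectional k m (?A k)" "\<exists>m'. tame r (real ?p ^ k * \<theta>) m' (?A k)" for k
  proof -
    show "?A k \<in> WX" for k by (rule ppow_funpow_WX[OF a(1)])
    note W = this
    show "sectional k m (?A k)"
      by (induction k) (use a tame_imp_sectional in \<open>simp_all add: sectional_ppow[OF W]\<close>)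
    show "\<exists>m'. tame r (real ?p ^ k * \<theta>) m' (?A k)"
    proof (induction k)
      case (Suc k)
      then obtain m' where "tame r (real ?p ^ k * \<theta>) m' (?A k)" by blast
      from tame_ppow[OF W this] \<theta> show ?case by (auto simp: mult.assoc)
    qed (use a in auto)
  qed
  \<comment> \<open>Setting \<open>q\<close> further variables to zero will take away q (p - 1) from
    the largest possible degree, more than the slack \<open>m\<close>.\<close>
  obtain q :: nat where q: "m < real q * (real ?p - 1)"
    using reals_Archimedean3[of "real ?p - 1"] p by auto
  \<comment> \<open>As p^k outgrows r^k, the gain p^k \<theta> eventually exceeds the weights of the
    first k + q variables; their values then have negative level and vanish.\<close>
  have "1 < real ?p / r" using r by simp
  then obtain k where "r ^ q / \<theta> < (real ?p / r) ^ k" using real_arch_pow by blast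
  then have k: "r ^ (k + q) < real ?p ^ k * \<theta>"
    using r \<theta> by (simp add: field_simps power_add)
  obtain m' where tame: "tame r (real ?p ^ k * \<theta>) m' (?A k)" using A by blast
  let ?g = "\<lambda>n. dact (?A k) (Suc n) (rgen n)"
  have X: "?g n \<in> Xpow n" for n by (rule tame_Xpow[OF tame])
  have z: "?g n = 0" if "n < k + q" for n
  proof (rule wsub_eq_0)
    show "?g n \<in> wsub ((^) r) n (r ^ n - real ?p ^ k * \<theta>)" using tame by (simp add: tame_def)
    have "r ^ n \<le> r ^ (k + q)" using that r by (intro power_increasing) auto
    moreover fix e :: "nat \<Rightarrow> nat"
    have "0 \<le> (\<Sum>i<n. r ^ i * real (e i))" using r by (intro sum_nonneg) simp
    ultimately show "r ^ n - real ?p ^ k * \<theta> < (\<Sum>i<n. r ^ i * real (e i))"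
      using k by linarith
  qed
  have ideal: "\<exists>i<k + q. e i \<noteq> 0" if n: "k + q \<le> n" and e: "?g n e \<noteq> 0" for n e
  proof (rule ccontr)
    assume "\<not> ?thesis"
    then have e0: "e i = 0" if "i < k + q" for i using that by blast
    have "(real n - real k) * (real ?p - 1) \<le> (\<Sum>i<n. real (e i)) + m"
      using A(2)[of k] e e0 by (simp add: sectional_def)
    also have "(\<Sum>i<n. real (e i)) = (\<Sum>i=k+q..<n. real (e i))"
      using e0 by (intro sum.mono_neutral_right) (auto simp: not_le)
    also have "\<dots> \<le> (\<Sum>i=k+q..<n. real ?p - 1)"
    proof (rule sum_mono)
      fix i assume "i \<in> {k+q..<n}"
      then have "Suc (e i) \<le> ?p" using XpowD[OF X, OF e] by (simp add: midx_def Suc_le_eq)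
      then have "real (Suc (e i)) \<le> real ?p" by (simp only: of_nat_le_iff)
      then show "real (e i) \<le> real ?p - 1" by simp
    qed
    also have "\<dots> = (real n - real k) * (real ?p - 1) - real q * (real ?p - 1)"
      using n by (simp add: of_nat_diff algebra_simps)
    finally show False using q by simp
  qed
  have "\<exists>j. (ppow ^^ j) (?A k) = 0"
    by (rule nil_of_ideal[OF A(1) X]) (fact z, fact ideal)
  then obtain j where "(ppow ^^ j) (?A k) = 0" by blast
  then have "(ppow ^^ (j + k)) a = 0" by (simp add: funpow_add)
  then show ?thesis by blast
qed

section \<open>Bounded evanescent elements are tame\<close>

lemma pure_in_varpi_power:
  "s \<le> (\<Sum>i<n. d i) \<Longrightarrow> pure n (\<lambda>i. tvar ^ d i) \<in> (varpi_power s :: 'k::idom_prime_char tens set)"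
proof (induction s arbitrary: d)
  case 0
  then show ?case by (auto simp: RX_def intro!: exI[of _ n])
next
  case (Suc s)
  then have "(\<Sum>i<n. d i) \<noteq> 0" by linarith
  then obtain m where m: "m < n" "d m > 0"
    by (metis gr0I lessThan_iff sum.neutral)
  let ?x = "(\<lambda>_. 1)(m := tvar) :: nat \<Rightarrow> 'k trunc" and ?d = "d(m := d m - 1)"
  have "(\<Sum>i<n. d i) = Suc (\<Sum>i<n. ?d i)" using m by (simp add: sum.remove[of _ m])
  then have IH: "pure n (\<lambda>i. tvar ^ ?d i) \<in> (varpi_power s :: 'k tens set)"
    using Suc.prems by (intro Suc.IH) simp
  have "taug (tvar :: 'k trunc) = 0" by transfer simp
  then have "raug (pure n ?x) = 0"
    unfolding raug_pure using m by (intro prod_zero) auto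
  then have x: "pure n ?x \<in> varpi" by (auto simp: varpi_def RX_def simp del: fun_upd_apply intro!: exI[of _ n])
  have "pure n (\<lambda>i. tvar ^ d i) = rmult (pure n ?x) (pure n (\<lambda>i. tvar ^ ?d i))"
    unfolding rmult_pure using m
    by (intro pure_cong) (auto simp: power_Suc[symmetric] simp del: power_Suc)
  then show ?case
    using x IH by (auto intro!: kscale.span_base simp del: fun_upd_apply)
qed

text \<open>If x^e had codegree n (p - 1) - \<Sum> e i at least \<open>m\<close>, the monomial with
  the complementary exponents would lie in \<open>varpi_power m\<close> without annihilating
  \<open>a n\<close>.\<close>

lemma bounded_elt_codegree:
  fixes a :: "'k::idom_prime_char wel"
  assumes "a \<in> WX" "bounded_elt a"
  shows "\<exists>m. \<forall>n e. a n e \<noteq> 0 \<longrightarrow> n * (CHAR('k) - 1) < (\<Sum>i<n. e i) + m"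
proof -
  let ?p = "CHAR('k)"
  obtain m where m: "\<And>f i. f \<in> varpi_power m \<Longrightarrow> ract f i (a i) = 0"
    using assms(2) unfolding bounded_elt_def by blast
  have "n * (?p - 1) < (\<Sum>i<n. e i) + m" if "a n e \<noteq> 0" for n e
  proof (rule ccontr)
    assume neg: "\<not> ?thesis"
    have e: "e \<in> midx ?p n" using assms(1) that by (auto simp: WX_def XDer_def)
    then have le: "e i \<le> ?p - 1" if "i < n" for i using that by (force simp: midx_def)
    \<comment> \<open>The monomial \<open>x^d\<close> complementary to \<open>x^e\<close> moves the coefficient of \<open>x^e\<close> to the top degree.\<close>
    define top where "top = (\<lambda>i. if i < n then ?p - 1 else 0)"
    define d where "d = top - e"
    have top: "top \<in> midx ?p n" using CHAR_gt_1[where 'k='k] by (auto simp: midx_def top_def)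
    have d: "d \<in> midx ?p n" using top by (auto simp: midx_def d_def minus_apply intro: less_imp_diff_less)
    have "d \<le> top" and de: "top - d = e"
      using le e by (auto simp: d_def top_def midx_def le_fun_def fun_eq_iff minus_apply)
    have "(\<Sum>i<n. d i) = (\<Sum>i<n. ?p - 1 - e i)" by (simp add: d_def top_def minus_apply)
    also have "\<dots> = n * (?p - 1) - (\<Sum>i<n. e i)" using le by (subst sum_subtractf_nat) auto
    finally have "m \<le> (\<Sum>i<n. d i)" using neg by simp
    note r = m[OF pure_in_varpi_power[OF this], of n]
    have "a n e x = 0" for x
    proof -
      have "0 = ract (pure n (\<lambda>i. tvar ^ d i)) n (a n) top x" using r by (simp add: zero_fun_apply)
      also have "\<dots> = (\<Sum>d'\<in>{..top}. if d' = d then a n e x else 0)"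
        unfolding ract_def using top de
        by (auto simp: pure_mono_apply[OF d] intro!: sum.cong)
      also have "\<dots> = a n e x"
        using \<open>d \<le> top\<close> finite_atMost_midx[OF top] by simp
      finally show ?thesis by simp
    qed
    then show False using that by (auto simp: fun_eq_iff zero_fun_apply)
  qed
  then show ?thesis by blast
qed

section \<open>Evanescence as a bound on weights\<close>

lemma sum_list_dotimes_apply:
  "(\<Sum>v\<leftarrow>vs. dotimes v \<delta>) e f = tscale (\<Sum>v\<leftarrow>vs. v e) (\<delta> f)"
  by (induction vs) (auto simp: zero_fun_apply plus_fun_apply dotimes_def tscale.scale_left_distrib)

text \<open>Since \<open>ddx\<close> maps the variable to 1, the value does not involve the
  differentiated variable itself. This puts the values of evanescent elements in
  \<open>Xpow n\<close>.\<close>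

lemma dact_rgen_dotimes:
  fixes a :: "'k::idom_prime_char wel"
  assumes a: "a \<in> WX" and eq: "\<And>e f. a n e f = tscale (v e) (ddx f)"
  shows "dact a (Suc n) (rgen n) = v"
proof
  fix e
  have 1: "tcoeff (1 :: 'k trunc) j = (if j = 0 then 1 else 0)" for j
    using tcoeff_tvar_power[of 0 j, where 'k='k] CHAR_pos[where 'a='k] by auto
  have t: "tcoeff (a n e tvar) j = (if j = 0 then v e else 0)" for e j
    by (simp add: eq ddx_tvar 1)
  have v: "v e = 0" if "e \<notin> midx CHAR('k) n" for e
  proof -
    have "a n e = 0" using a that by (auto simp: WX_def XDer_def)
    then show ?thesis using t[of e 0] by (simp add: zero_fun_apply)
  qed
  have m: "e \<in> midx CHAR('k) (Suc n) \<and> e n = 0 \<longleftrightarrow> e \<in> midx CHAR('k) n"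
    using CHAR_pos[where 'a='k] by (auto simp: midx_def less_Suc_eq Suc_le_eq) (metis le_neq_implies_less)
  have "e(n := 0) = e" if "e n = 0" using that by auto
  then show "dact a (Suc n) (rgen n) e = v e"
    using m v[of e] by (auto simp: dact_rgen_apply[OF a] t simp del: fun_upd_apply)
qed

text \<open>A nonzero coefficient comes from some summand of the evanescent form. The factor
  \<open>c\<close> occupies the last \<open>min n l\<close> positions, whence the shift by n -
  l.\<close>

lemma evanescent_coefficients:
  fixes a :: "'k::idom_prime_char wel"
  assumes a: "a \<in> WX" and ev: "evanescent l a" and e: "dact a (Suc n) (rgen n) e \<noteq> 0"
  shows "a n e \<noteq> 0" "(\<Sum>i<min n l. e (i + (n - l))) < (CHAR('k) - 1) * l"
proof -
  obtain bcs where bcs: "\<forall>(b, c)\<in>set bcs. b \<in> Xpow (n - l) \<and> c \<in> Xpow (min n l) \<and>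
      deg_less (min n l) c ((CHAR('k) - 1) * l)"
    and an: "a n = (\<Sum>(b, c)\<leftarrow>bcs. dotimes (otimes (n - l) b c) ddx)"
    using ev unfolding evanescent_def by blast
  let ?vs = "map (\<lambda>(b, c). otimes (n - l) b c) bcs"
  have "a n = (\<Sum>v\<leftarrow>?vs. dotimes v ddx)"
    unfolding an by (simp add: case_prod_unfold o_def)
  then have an': "a n e f = tscale (\<Sum>v\<leftarrow>?vs. v e) (ddx f)" for e f
    by (simp only: sum_list_dotimes_apply)
  have g: "dact a (Suc n) (rgen n) = (\<lambda>e. \<Sum>v\<leftarrow>?vs. v e)"
    by (rule dact_rgen_dotimes[OF a an'])
  show "a n e \<noteq> 0"
  proof
    assume "a n e = 0"
    then have "a n e tvar = 0" by (simp add: zero_fun_apply)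
    then have "tscale (\<Sum>v\<leftarrow>?vs. v e) 1 = (0 :: 'k trunc)" by (simp add: an' ddx_tvar)
    then have "tcoeff (tscale (\<Sum>v\<leftarrow>?vs. v e) (tvar ^ 0)) 0 = (0 :: 'k)" by simp
    then have "(\<Sum>v\<leftarrow>?vs. v e) = 0"
      unfolding tcoeff_tscale tcoeff_tvar_power using CHAR_pos[where 'a='k] by simp
    then show False using e unfolding g by simp
  qed
  have "\<exists>v\<in>set ?vs. v e \<noteq> 0"
  proof (rule ccontr)
    assume "\<not> ?thesis"
    then have "map (\<lambda>v. v e) ?vs = map (\<lambda>_. 0) ?vs" by (intro map_cong refl) blast
    then have "(\<Sum>v\<leftarrow>?vs. v e) = (\<Sum>v\<leftarrow>?vs. 0)" by (rule arg_cong)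
    then show False using e unfolding g sum_list_0 by (rule notE[rotated])
  qed
  then obtain b c where "(b, c) \<in> set bcs" "otimes (n - l) b c e \<noteq> 0" by auto
  then have "deg_less (min n l) c ((CHAR('k) - 1) * l)" "c (\<lambda>i. e (i + (n - l))) \<noteq> 0"
    using bcs by (auto simp: otimes_def)
  then show "(\<Sum>i<min n l. e (i + (n - l))) < (CHAR('k) - 1) * l" unfolding deg_less_def by blast
qed

text \<open>If all exponents were p - 1, the weight would be (p - 1) (r^n - 1) / (r - 1), which for
  large \<open>n\<close> exceeds r^n because r < p. For n \<ge> l evanescence forces an exponent at
  most p - 2 among the last \<open>l\<close> positions, saving at least r^(n-l); the third condition
  on \<open>r\<close> makes this saving sufficient. For n < l that condition suffices without a
  saving.\<close>

lemma evanescent_weight: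
  fixes e :: "nat \<Rightarrow> nat" and p l n :: nat
  assumes e: "e \<in> midx p n" "(\<Sum>i<min n l. e (i + (n - l))) < (p - 1) * l"
    and r: "1 < r" "r < real p" "r ^ l * (real p - r) \<le> r - 1"
  shows "(\<Sum>i<n. r ^ i * real (e i)) \<le> r ^ n - (real p - r) / (r - 1)"
proof -
  have le: "real (e i) \<le> real p - 1" if "i < n" for i
  proof -
    have "Suc (e i) \<le> p" using e(1) that by (simp add: midx_def Suc_le_eq)
    then have "real (Suc (e i)) \<le> real p" by (simp only: of_nat_le_iff)
    then show ?thesis by simp
  qed
  define S where "S = (\<Sum>i<n. r ^ i * real (e i))"
  define G where "G = (\<Sum>i<n. r ^ i)"
  have G: "G * (r - 1) = r ^ n - 1" using r by (simp add: G_def geometric_sum)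
  have "S * (r - 1) \<le> r ^ n * (r - 1) - (real p - r)"
  proof (cases "n < l")
    case True
    have "S \<le> (\<Sum>i<n. r ^ i * (real p - 1))"
      unfolding S_def using r le by (intro sum_mono mult_left_mono) auto
    also have "\<dots> = G * (real p - 1)" by (simp add: G_def sum_distrib_right)
    finally have "S * (r - 1) \<le> (G * (r - 1)) * (real p - 1)"
      using r mult_right_mono[of S "G * (real p - 1)" "r - 1"] by (simp add: mult_ac)
    also have "\<dots> = (r ^ n - 1) * (real p - 1)" by (simp only: G)
    finally have *: "S * (r - 1) \<le> (r ^ n - 1) * (real p - 1)" .
    have "r ^ n * (real p - r) \<le> r ^ l * (real p - r)"
      using True r by (intro mult_right_mono power_increasing) auto
    with * r(3) show ?thesis by (simp add: algebra_simps)
  next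
    case False
    have "\<exists>j. n - l \<le> j \<and> j < n \<and> e j \<noteq> p - 1"
    proof (rule ccontr)
      assume "\<not> ?thesis"
      then have "(\<Sum>i<l. e (i + (n - l))) = (\<Sum>i<l. p - 1)"
        using False by (intro sum.cong) auto
      then show False using e(2) False by (simp add: min_absorb2 mult.commute)
    qed
    then obtain j where j: "n - l \<le> j" "j < n" "e j \<noteq> p - 1" by blast
    then have ej: "real (e j) \<le> real p - 2"
    proof -
      have "e j + 2 \<le> p" using j e(1) by (force simp: midx_def)
      then have "real (e j + 2) \<le> real p" by (simp only: of_nat_le_iff)
      then show ?thesis by simp
    qed
    have "S = r ^ j * real (e j) + (\<Sum>i\<in>{..<n}-{j}. r ^ i * real (e i))"
      unfolding S_def using j by (simp add: sum.remove)
    also have "\<dots> \<le> r ^ j * (real p - 2) + (\<Sum>i\<in>{..<n}-{j}. r ^ i * (real p - 1))"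
      using r le ej by (intro add_mono sum_mono mult_left_mono) auto
    also have "\<dots> = (\<Sum>i<n. r ^ i * (real p - 1)) - r ^ j"
      using j by (simp add: sum.remove[of "{..<n}" j] algebra_simps)
    also have "\<dots> = G * (real p - 1) - r ^ j" by (simp add: G_def sum_distrib_right)
    also have "\<dots> \<le> G * (real p - 1) - r ^ (n - l)"
      using r j by (simp add: power_increasing)
    finally have "S * (r - 1) \<le> (G * (r - 1)) * (real p - 1) - r ^ (n - l) * (r - 1)"
      using r mult_right_mono[of S "G * (real p - 1) - r ^ (n - l)" "r - 1"]
      by (simp add: algebra_simps)
    then have *: "S * (r - 1) \<le> (r ^ n - 1) * (real p - 1) - r ^ (n - l) * (r - 1)"
      by (simp only: G)
    have "r ^ n * (real p - r) = r ^ (n - l) * (r ^ l * (real p - r))"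
      using False by (simp flip: power_add mult.assoc)
    also have "\<dots> \<le> r ^ (n - l) * (r - 1)"
      using r by (intro mult_left_mono) auto
    finally have "r ^ n * (real p - r) \<le> r ^ (n - l) * (r - 1)" .
    moreover have "0 < r - 1" using r by simp
    ultimately show ?thesis using * by (simp add: algebra_simps)
  qed
  moreover have "(r ^ n - (real p - r) / (r - 1)) * (r - 1) = r ^ n * (r - 1) - (real p - r)"
    using r by (simp only: left_diff_distrib) simp
  ultimately have "S * (r - 1) \<le> (r ^ n - (real p - r) / (r - 1)) * (r - 1)" by simp
  then show ?thesis using r unfolding S_def by simp
qed

lemma bounded_evanescent_tame:
  fixes a :: "'k::idom_prime_char wel"
  assumes a: "a \<in> WX" "bounded_elt a" "evanescent l a"
    and r: "1 < r" "r < real CHAR('k)" "r ^ l * (real CHAR('k) - r) \<le> r - 1"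
  shows "\<exists>m. tame r ((real CHAR('k) - r) / (r - 1)) m a"
proof -
  let ?p = "CHAR('k)"
  obtain m where m: "\<And>n e. a n e \<noteq> 0 \<Longrightarrow> n * (?p - 1) < (\<Sum>i<n. e i) + m"
    using bounded_elt_codegree[OF a(1,2)] by blast
  have "tame r ((real ?p - r) / (r - 1)) (real m) a"
    unfolding tame_def wsub_def
  proof (intro allI conjI CollectI impI)
    fix n
    let ?g = "dact a (Suc n) (rgen n)"
    have X: "e \<in> midx ?p n" if "?g e \<noteq> 0" for e
      using evanescent_coefficients(1)[OF a(1,3) that] a(1) by (auto simp: WX_def XDer_def)
    then show Xp: "?g \<in> Xpow n" "?g \<in> Xpow n" by (auto simp: Xpow_def)
    fix e assume e: "?g e \<noteq> 0"
    note ev = evanescent_coefficients[OF a(1,3) e]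
    show "(\<Sum>i<n. r ^ i * real (e i)) \<le> r ^ n - (real ?p - r) / (r - 1)"
      by (rule evanescent_weight[OF X[OF e] ev(2) r])
    have p: "real (?p - 1) = real ?p - 1" by (simp add: of_nat_diff Suc_le_eq)
    have "real (n * (?p - 1)) \<le> real ((\<Sum>i<n. e i) + m)"
      using m[OF ev(1)] by (simp only: of_nat_le_iff)
    then show "(\<Sum>i<n. - 1 * real (e i)) \<le> real m - real n * (real ?p - 1)"
      by (simp add: p sum_negf del: One_nat_def)
  qed
  then show ?thesis by blast
qed

lemma weight_base_exists:
  fixes p l :: nat
  assumes "1 < p"
  obtains r :: real where "1 < r" "r < real p" "r ^ l * (real p - r) \<le> r - 1"
proof
  \<comment> \<open>\<open>r = p - d\<close>, with \<open>d\<close> solving \<open>p^l d = 1 - d\<close>\<close>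
  define d where "d = 1 / (real p ^ l + 1)"
  have p: "real p \<ge> 2" using assms by simp
  have P: "real p ^ l \<ge> 1" using p by simp
  then have d: "0 < d" "d \<le> 1 / 2" "d * (real p ^ l + 1) = 1" by (auto simp: d_def field_simps)
  show "1 < real p - d" "real p - d < real p" using p d by auto
  have "(real p - d) ^ l * d \<le> real p ^ l * d"
    using p d by (intro mult_right_mono power_mono) auto
  also have "\<dots> = 1 - d" using d(3) by (simp add: algebra_simps)
  finally show "(real p - d) ^ l * (real p - (real p - d)) \<le> real p - d - 1" using p by simp
qed

theorem corollary2p9:
  fixes p l :: nat and S L :: "'k::idom_prime_char wel set"
  assumes "prime p" and "CHAR('k) = p"
    and "S \<subseteq> WX"
    and "\<forall>a\<in>S. bounded_elt a \<and> evanescent l a"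
    and "L = restricted_subalgebra hull S"
  shows "nil_algebra L"
proof -
  obtain r where r: "1 < r" "r < real CHAR('k)" "r ^ l * (real CHAR('k) - r) \<le> r - 1"
    using weight_base_exists[OF CHAR_gt_1[where 'k='k]] .
  \<comment> \<open>Both \<open>r\<close> and \<theta> depend on p and \<open>l\<close> only. As
    \<open>l\<close> is common to all generators, so is the weight filtration; only the degree
    constants vary.\<close>
  define \<theta> where "\<theta> = (real CHAR('k) - r) / (r - 1)"
  have \<theta>: "0 < \<theta>" using r by (simp add: \<theta>_def)
  have "L \<subseteq> {a. a \<in> WX \<and> (\<exists>m. tame r \<theta> m a)}"
    unfolding assms(5)
  proof (rule hull_minimal)
    show "S \<subseteq> {a. a \<in> WX \<and> (\<exists>m. tame r \<theta> m a)}"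
      using assms(3,4) bounded_evanescent_tame[OF _ _ _ r] unfolding \<theta>_def by blast
  qed (rule restricted_subalgebra_tame[OF less_imp_le[OF \<theta>]])
  then show ?thesis
    using tame_nil[OF _ _ r(1,2) \<theta>] unfolding nil_algebra_def by blast
qed

end
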